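(* Let $\Theta\subseteq\mathbb R^d$ be convex, let $n>0$, and let $f\in C^2(\Theta)$ be convex with unique strict global minimizer $\hat\theta\in\Theta$ such that $H:=\nabla^2 f(\hat\theta)$ is positive definite. For $r\ge 0$ let $\mathcal U(r)=\{\theta\in\mathbb R^d: |\theta-\hat\theta|_H\le r\sqrt{d/n}\}$. Assume there is $r\geq 6$ such that $\mathcal U(r)\subset\Theta$, let $$\delta_3(r)=\sup_{\theta\in\mathcal U(r),\,\theta\neq\hat\theta}\frac{\|\nabla^2 f(\theta)-\nabla^2 f(\hat\theta)\|_H}{|\theta-\hat\theta|_H},$$ and suppose $r\,\delta_3(r)\sqrt{d/n}\leq 1/2$. Then $e^{-nf}\in L^1(\Theta)$, so the probability density $\pi_f(\theta)\propto e^{-nf(\theta)}$, $\theta\in\Theta$, is well-defined, and with $\gamma_f=\mathcal N(\hat\theta,(nH)^{-1})$ we have $$\mathrm{TV}(\pi_f,\gamma_f)\leq \frac{\delta_3(r)\,d}{\sqrt{2n}}+3e^{-dr^2/9}.$$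
   Context: $|\cdot|$ is the Euclidean norm on $\mathbb R^d$. For a symmetric positive definite matrix $A$ and a vector $u$, $|u|_A=|A^{1/2}u|$; for a symmetric matrix $S$, $\|S\|_A=\|A^{-1/2}SA^{-1/2}\|$ with $\|\cdot\|$ the matrix operator norm. $\mathrm{TV}(P,Q)=\sup_B|P(B)-Q(B)|$ is the total variation distance between probability measures on $\mathbb R^d$; $\pi_f$ is extended by $0$ outside $\Theta$. *)

theory Defs
  imports "HOL-Probability.Probability"
begin

text \<open>Derivatives are taken within \<open>S\<close>, so that they make sense at boundary points of a set that
  need not be open. For convex \<open>S\<close> with nonempty interior they are uniquely determined on \<open>S\<close>, and
  \<open>C2_on S f\<close> says that \<open>f\<close> is \<open>C\<^sup>2\<close> in the interior with all derivatives up to order two extending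
  continuously to \<open>S\<close>. Values of \<open>f\<close> outside \<open>S\<close> play no role.\<close>

definition gradient_within :: "(real^'d) set \<Rightarrow> (real^'d \<Rightarrow> real) \<Rightarrow> real^'d \<Rightarrow> real^'d" where
  "gradient_within S f x = (\<chi> i. frechet_derivative f (at x within S) (axis i 1))"

definition hessian_within :: "(real^'d) set \<Rightarrow> (real^'d \<Rightarrow> real) \<Rightarrow> real^'d \<Rightarrow> real^'d^'d" where
  "hessian_within S f x = matrix (frechet_derivative (gradient_within S f) (at x within S))"

definition C2_on :: "(real^'d) set \<Rightarrow> (real^'d \<Rightarrow> real) \<Rightarrow> bool" where
  "C2_on S f \<longleftrightarrow> f differentiable_on S \<and> gradient_within S f differentiable_on S \<and>
     continuous_on S (hessian_within S f)"

definition strict_global_minimizer :: "'a set \<Rightarrow> ('a \<Rightarrow> real) \<Rightarrow> 'a \<Rightarrow> bool" where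
  "strict_global_minimizer S f x \<longleftrightarrow> x \<in> S \<and> (\<forall>y\<in>S. y \<noteq> x \<longrightarrow> f x < f y)"

definition pos_def :: "real^'d^'d \<Rightarrow> bool" where
  "pos_def A \<longleftrightarrow> transpose A = A \<and> (\<forall>x. x \<noteq> 0 \<longrightarrow> 0 < x \<bullet> (A *v x))"

text \<open>The positive definite square root; only meaningful for positive definite \<open>A\<close>.\<close>

definition matrix_sqrt :: "real^'d^'d \<Rightarrow> real^'d^'d" where
  "matrix_sqrt A = (THE B. pos_def B \<and> B ** B = A)"

definition vec_norm_wrt :: "real^'d^'d \<Rightarrow> real^'d \<Rightarrow> real" where
  "vec_norm_wrt A u = norm (matrix_sqrt A *v u)"

definition mat_norm_wrt :: "real^'d^'d \<Rightarrow> real^'d^'d \<Rightarrow> real" where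
  "mat_norm_wrt A S =
     onorm ((*v) (matrix_inv (matrix_sqrt A) ** S ** matrix_inv (matrix_sqrt A)))"

definition local_region :: "real \<Rightarrow> real^'d^'d \<Rightarrow> real^'d \<Rightarrow> real \<Rightarrow> (real^'d) set" where
  "local_region n H m r = {x. vec_norm_wrt H (x - m) \<le> r * sqrt (real CARD('d) / n)}"

text \<open>The supremum may be infinite, since \<open>f\<close> is only \<open>C\<^sup>2\<close>; hence it is taken in the extended
  reals.\<close>

definition delta3 ::
  "(real^'d) set \<Rightarrow> (real^'d \<Rightarrow> real) \<Rightarrow> real \<Rightarrow> real^'d \<Rightarrow> real \<Rightarrow> ereal" where
  "delta3 S f n m r =
     (let H = hessian_within S f m in
      SUP x \<in> local_region n H m r - {m}.
        ereal (mat_norm_wrt H (hessian_within S f x - H) / vec_norm_wrt H (x - m)))"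

text \<open>A convex set is Lebesgue measurable but not necessarily Borel, so this measure lives on the
  Lebesgue sets.\<close>

definition gibbs_measure :: "(real^'d) set \<Rightarrow> real \<Rightarrow> (real^'d \<Rightarrow> real) \<Rightarrow> (real^'d) measure" where
  "gibbs_measure S n f = density lebesgue
     (\<lambda>x. ennreal (indicator S x * exp (- n * f x) / (LINT y:S|lebesgue. exp (- n * f y))))"

definition gaussian_measure :: "real^'d \<Rightarrow> real^'d^'d \<Rightarrow> (real^'d) measure" where
  "gaussian_measure m \<Sigma> = density lborel
     (\<lambda>x. ennreal (exp (- ((x - m) \<bullet> (matrix_inv \<Sigma> *v (x - m))) / 2)
                   / sqrt ((2 * pi) ^ CARD('d) * det \<Sigma>)))"

definition total_variation :: "(real^'d) measure \<Rightarrow> (real^'d) measure \<Rightarrow> real" where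
  "total_variation P Q = (SUP B \<in> sets borel. \<bar>measure P B - measure Q B\<bar>)"

end

theory Submission imports Defs
begin

text \<open>In the coordinates \<open>x = sqrt (n H) (\<theta> - \<theta>')\<close> the potential \<open>V = n (f - f \<theta>')\<close> satisfies
  \<open>|\<nabla>V x - x| \<le> L |x|\<^sup>2 / 2\<close> with \<open>L = \<delta>\<^sub>3 / sqrt n\<close> on the ball of radius \<open>R = r sqrt d\<close>, and \<open>L R \<le> 1/2\<close>.
  Let \<open>q\<close> be \<open>exp (- V)\<close> times a cutoff that descends from 1 to 0 on the outer sixth of the ball, and \<open>F\<close>
  its quotient by the Gaussian weight. No logarithmic Sobolev inequality is needed: rotating a pair of
  independent Gaussian vectors into each other (Maurey--Pisier) gives \<open>E |F X - F Y| \<le> \<pi>/2 k E |\<nabla>F X|\<close>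
  where \<open>E |u \<bullet> X| \<le> k\<close> for unit vectors \<open>u\<close>, and this bounds the total variation distance between \<open>q\<close>
  and the Gaussian by a multiple of \<open>L\<close> times the second moment of \<open>q\<close>, plus a cutoff error. Since
  \<open>x \<bullet> \<nabla>V x \<ge> 3/4 |x|\<^sup>2\<close>, comparing \<open>q\<close> with its dilations bounds this second moment by \<open>4 d / 3\<close>.
  By convexity \<open>V\<close> grows at least linearly along rays, so all errors from outside the ball of radius
  \<open>5 R / 6\<close> are controlled by the integral of \<open>exp (- c |x|)\<close> there, which for \<open>r \<ge> 6\<close> is smaller than
  \<open>exp (- d r\<^sup>2 / 9) / 2\<close>.\<close>

subsection \<open>Gaussian integrals\<close>

text \<open>The rotation argument forces the cutoff: the path between two points of the ball can
  leave it (norms up to sqrt 2 times the radius occur), while the gradient of \<open>V\<close> is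
  controlled only inside, so \<open>F\<close> must be C^1 on the whole space. Staying in L^1 keeps
  the dependence on the dimension right: the quadratic error |v x - x| then costs only a second
  moment, which is of order d. The constants combine as follows: 1/2 from testing against a set,
  pi/2 * 117/100 \<le> 19/10 from the rotation, and L/2 * 4/3 d from the moment. The product 19/30 L
  d lies below L d / sqrt 2, and this slack is why a crude absolute Gaussian moment suffices. The
  exponential tolerance is 6 \<open>\<tau>\<close>, of which 7/2 \<open>\<tau>\<close> are spent.
  The fraction 5/6 balances two demands: the tail exponent 25/144 d r^2 has to exceed d r^2 / 9 with
  room for a volume factor per dimension, and the cutoff layer has width R/6 \<ge> 1, so that its
  slope stays bounded.\<close>

lemma nn_integral_lborel_affine:
  fixes t :: "'a::euclidean_space" and f :: "'a \<Rightarrow> ennreal"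
  assumes [measurable]: "f \<in> borel_measurable borel" and c: "c \<noteq> 0"
  shows "(\<integral>\<^sup>+x. f x \<partial>lborel) = ennreal (\<bar>c\<bar> ^ DIM('a)) * (\<integral>\<^sup>+x. f (t + c *\<^sub>R x) \<partial>lborel)"
  by (subst lborel_affine[OF c, of t])
     (simp add: nn_integral_density nn_integral_distr nn_integral_cmult)

lemma nn_integral_lborel_gaussian_real:
  assumes c: "c > (0::real)"
  shows "(\<integral>\<^sup>+x. ennreal (exp (- (c * x\<^sup>2))) \<partial>lborel) = ennreal (sqrt (pi / c))"
proof -
  define \<sigma> where "\<sigma> = sqrt (1 / (2 * c))"
  have s: "\<sigma> > 0" "\<sigma>\<^sup>2 = 1 / (2 * c)" using c by (auto simp: \<sigma>_def)
  have e: "exp (- (c * x\<^sup>2)) = sqrt (pi / c) * normal_density 0 \<sigma> x" for x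
    using c by (simp add: normal_density_def s(2) real_sqrt_divide)
  have "(\<integral>\<^sup>+x. ennreal (normal_density 0 \<sigma> x) \<partial>lborel) = 1"
    using s by (subst nn_integral_eq_integral) (auto simp: normal_density_nonneg)
  then show ?thesis using c
    by (simp add: e ennreal_mult' nn_integral_cmult)
qed

lemma nn_integral_lborel_gaussian:
  assumes c: "c > (0::real)"
  shows "(\<integral>\<^sup>+x. ennreal (exp (- (c * (norm x)\<^sup>2))) \<partial>(lborel :: 'a::euclidean_space measure))
    = ennreal (sqrt (pi / c) ^ DIM('a))"
proof -
  have "exp (- (c * (norm x)\<^sup>2)) = (\<Prod>b\<in>Basis. exp (- (c * (x \<bullet> b)\<^sup>2)))" for x :: 'a
  proof -
    have "(norm x)\<^sup>2 = (\<Sum>b\<in>Basis. (x \<bullet> b)\<^sup>2)"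
      by (subst power2_norm_eq_inner, subst euclidean_inner) (simp add: power2_eq_square)
    then show ?thesis by (simp add: exp_sum[symmetric] sum_distrib_left sum_negf)
  qed
  then have "(\<integral>\<^sup>+x. ennreal (exp (- (c * (norm x)\<^sup>2))) \<partial>(lborel :: 'a measure))
    = (\<integral>\<^sup>+x. (\<Prod>b\<in>Basis. ennreal (exp (- (c * (x \<bullet> b)\<^sup>2)))) \<partial>(lborel :: 'a measure))"
    by (simp add: prod_ennreal)
  also have "\<dots> = (\<Prod>b\<in>(Basis::'a set). \<integral>\<^sup>+x. ennreal (exp (- (c * x\<^sup>2))) \<partial>lborel)"
    by (rule nn_integral_lborel_prod) auto
  also have "\<dots> = ennreal (sqrt (pi / c)) ^ DIM('a)"
    using nn_integral_lborel_gaussian_real[OF c] by simp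
  finally show ?thesis using c by (simp add: ennreal_power)
qed

lemma has_bochner_integral_gaussian:
  assumes c: "c > 0"
  shows "has_bochner_integral lborel (\<lambda>x :: 'a::euclidean_space. exp (- (c * (norm x)\<^sup>2))) (sqrt (pi / c) ^ DIM('a))"
  using c by (intro has_bochner_integral_nn_integral nn_integral_lborel_gaussian) auto

text \<open>Up to the factor 1/b the integrand is the exponential density plus its reflection,
  except that both count at 0. Domination by the sum avoids splitting the line, and an upper bound
  is all that the tail estimate needs.\<close>

lemma nn_integral_lborel_laplace_real:
  assumes b: "b > (0::real)"
  shows "(\<integral>\<^sup>+x. ennreal (exp (- (b * \<bar>x\<bar>))) \<partial>lborel) \<le> ennreal (2 / b)"
proof -
  have 1: "(\<integral>\<^sup>+x. ennreal (exponential_density b x) \<partial>lborel) = 1"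
    using prob_space.emeasure_space_1[OF prob_space_exponential_density[OF b]]
    by (simp add: emeasure_density)
  moreover have "(\<integral>\<^sup>+x. ennreal (exponential_density b x) \<partial>lborel)
      = (\<integral>\<^sup>+x. ennreal (exponential_density b (- x)) \<partial>lborel)"
    using nn_integral_lborel_affine[of "\<lambda>x. ennreal (exponential_density b x)" "-1" 0] by simp
  ultimately have 2: "(\<integral>\<^sup>+x. ennreal (exponential_density b (- x)) \<partial>lborel) = 1" by simp
  have "(\<integral>\<^sup>+x. ennreal (exp (- (b * \<bar>x\<bar>))) \<partial>lborel)
     \<le> (\<integral>\<^sup>+x. ennreal (1 / b) * (ennreal (exponential_density b x)
              + ennreal (exponential_density b (- x))) \<partial>lborel)"
  proof (intro nn_integral_mono)
    fix x :: real
    have "exp (- (b * \<bar>x\<bar>)) \<le> (1 / b) * (exponential_density b x + exponential_density b (- x))"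
      using b by (cases "x = 0") (auto simp: exponential_density_def field_simps)
    moreover have "ennreal (1 / b) * (ennreal A + ennreal B) = ennreal ((1 / b) * (A + B))"
      if "A \<ge> 0" "B \<ge> 0" for A B
      using b that by (subst ennreal_mult') auto
    moreover have "exponential_density b y \<ge> 0" for y
      using b by (simp add: exponential_density_def)
    ultimately show "ennreal (exp (- (b * \<bar>x\<bar>))) \<le> ennreal (1 / b) * (ennreal (exponential_density b x)
              + ennreal (exponential_density b (- x)))"
      by (simp add: ennreal_leI)
  qed
  also have "\<dots> = ennreal (1 / b) * (1 + 1)"
    by (simp add: nn_integral_cmult nn_integral_add 1 2)
  also have "\<dots> = ennreal (2 / b)"
    using b by (simp add: ennreal_plus[symmetric] ennreal_mult'[symmetric] del: ennreal_plus
       flip: ennreal_1 ennreal_numeral)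
  finally show ?thesis .
qed

lemma sum_abs_inner_Basis_le:
  fixes x :: "'a::euclidean_space"
  shows "(\<Sum>b\<in>Basis. \<bar>x \<bullet> b\<bar>) \<le> sqrt (DIM('a)) * norm x"
proof -
  have "(\<Sum>b\<in>Basis. \<bar>x \<bullet> b\<bar>) \<le> L2_set (\<lambda>b. x \<bullet> b) Basis * L2_set (\<lambda>b. 1) (Basis :: 'a set)"
    using L2_set_mult_ineq[of "\<lambda>b. x \<bullet> b" "\<lambda>b. 1" "Basis :: 'a set"] by simp
  also have "\<dots> = sqrt (DIM('a)) * norm x"
    by (simp add: L2_set_def norm_eq_sqrt_inner euclidean_inner[of x x] power2_eq_square)
  finally show ?thesis .
qed

text \<open>A substitute for polar coordinates: the bound of the l^1 norm by sqrt d |x| decouples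
  the coordinates and leaves a product of Laplace integrals. The loss is a bounded factor per
  dimension, for which \<open>w_integral\<close> has room.\<close>

lemma nn_integral_lborel_exp_norm:
  assumes b: "b > (0::real)"
  shows "(\<integral>\<^sup>+x. ennreal (exp (- (b * norm x))) \<partial>(lborel :: 'a::euclidean_space measure))
    \<le> ennreal ((2 * sqrt (DIM('a)) / b) ^ DIM('a))"
proof -
  define \<beta> where "\<beta> = b / sqrt (DIM('a))"
  have \<beta>: "\<beta> > 0" using b by (simp add: \<beta>_def)
  have "exp (- (b * norm x)) \<le> (\<Prod>b\<in>Basis. exp (- (\<beta> * \<bar>x \<bullet> b\<bar>)))" for x :: 'a
  proof -
    have "\<beta> * (\<Sum>b\<in>Basis. \<bar>x \<bullet> b\<bar>) \<le> \<beta> * (sqrt (DIM('a)) * norm x)"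
      using sum_abs_inner_Basis_le \<beta> by (intro mult_left_mono) auto
    also have "\<dots> = b * norm x" by (simp add: \<beta>_def)
    finally show ?thesis by (simp add: exp_sum[symmetric] sum_distrib_left sum_negf)
  qed
  then have "(\<integral>\<^sup>+x. ennreal (exp (- (b * norm x))) \<partial>(lborel :: 'a measure))
    \<le> (\<integral>\<^sup>+x. (\<Prod>b\<in>Basis. ennreal (exp (- (\<beta> * \<bar>x \<bullet> b\<bar>)))) \<partial>(lborel :: 'a measure))"
    by (intro nn_integral_mono) (simp add: prod_ennreal ennreal_leI)
  also have "\<dots> = (\<Prod>b\<in>(Basis::'a set). \<integral>\<^sup>+x. ennreal (exp (- (\<beta> * \<bar>x\<bar>))) \<partial>lborel)"
    by (rule nn_integral_lborel_prod) auto
  also have "\<dots> \<le> ennreal (2 / \<beta>) ^ DIM('a)"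
    using nn_integral_lborel_laplace_real[OF \<beta>] by (simp add: power_mono)
  also have "\<dots> = ennreal ((2 * sqrt (DIM('a)) / b) ^ DIM('a))"
    using \<beta> by (simp add: ennreal_power) (simp add: \<beta>_def)
  finally show ?thesis .
qed

section \<open>The standard Gaussian measure and its first absolute moment\<close>

definition std_gauss :: "'a::euclidean_space measure" where
  "std_gauss = density lborel (\<lambda>x. ennreal (exp (- (norm x)\<^sup>2 / 2) / sqrt (2 * pi) ^ DIM('a)))"

lemma sets_std_gauss [measurable_cong, simp]: "sets std_gauss = sets borel"
  and space_std_gauss [simp]: "space std_gauss = UNIV"
  by (auto simp: std_gauss_def)

lemma nn_integral_std_gauss:
  fixes f :: "'a::euclidean_space \<Rightarrow> ennreal"
  assumes [measurable]: "f \<in> borel_measurable borel"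
  shows "(\<integral>\<^sup>+x. f x \<partial>std_gauss)
    = ennreal (1 / sqrt (2 * pi) ^ DIM('a)) * (\<integral>\<^sup>+x. ennreal (exp (- (norm x)\<^sup>2 / 2)) * f x \<partial>lborel)"
proof -
  have "(\<integral>\<^sup>+x. f x \<partial>std_gauss)
    = (\<integral>\<^sup>+x. ennreal (1 / sqrt (2 * pi) ^ DIM('a)) * (ennreal (exp (- (norm x)\<^sup>2 / 2)) * f x) \<partial>lborel)"
    unfolding std_gauss_def
    by (subst nn_integral_density)
       (auto intro!: nn_integral_cong simp: mult.assoc[symmetric] ennreal_mult''[symmetric])
  then show ?thesis by (simp add: nn_integral_cmult)
qed

lemma integral_std_gauss:
  fixes f :: "'a::euclidean_space \<Rightarrow> real"
  assumes [measurable]: "f \<in> borel_measurable borel"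
  shows "(\<integral>x. f x \<partial>std_gauss)
    = (\<integral>x. f x * exp (- (norm x)\<^sup>2 / 2) \<partial>lborel) / sqrt (2 * pi) ^ DIM('a)"
proof -
  have "(\<integral>x. f x \<partial>std_gauss) = (\<integral>x. exp (- (norm x)\<^sup>2 / 2) / sqrt (2 * pi) ^ DIM('a) * f x \<partial>lborel)"
    unfolding std_gauss_def by (subst integral_density) auto
  also have "\<dots> = (\<integral>x. f x * exp (- (norm x)\<^sup>2 / 2) / sqrt (2 * pi) ^ DIM('a) \<partial>lborel)"
    by (simp add: mult.commute)
  finally show ?thesis by simp
qed

lemma prob_space_std_gauss: "prob_space (std_gauss :: 'a::euclidean_space measure)"
proof
  have "emeasure (std_gauss :: 'a measure) (space std_gauss) = (\<integral>\<^sup>+x. 1 \<partial>(std_gauss :: 'a measure))"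
    by simp
  also have "\<dots> = ennreal (1 / sqrt (2 * pi) ^ DIM('a)) * ennreal (sqrt (2 * pi) ^ DIM('a))"
    using nn_integral_lborel_gaussian[of "1/2", where 'a = 'a]
    by (subst nn_integral_std_gauss) (simp_all add: mult.commute[of pi])
  also have "\<dots> = 1" by (simp flip: ennreal_mult'')
  finally show "emeasure (std_gauss :: 'a measure) (space std_gauss) = 1" .
qed

interpretation std_gauss: prob_space "std_gauss :: 'a::euclidean_space measure"
  by (rule prob_space_std_gauss)

text \<open>Completing the square: the shift by \<open>v\<close> leaves the centred weight times a
  constant.\<close>

lemma nn_integral_std_gauss_exp_inner:
  fixes v :: "'a::euclidean_space"
  shows "(\<integral>\<^sup>+x. ennreal (exp (v \<bullet> x)) \<partial>std_gauss) = ennreal (exp ((norm v)\<^sup>2 / 2))"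
proof -
  have e: "ennreal (exp (- ((norm (v + x))\<^sup>2 / 2))) * ennreal (exp (v \<bullet> (v + x)))
      = ennreal (exp ((norm v)\<^sup>2 / 2)) * ennreal (exp (- ((norm x)\<^sup>2 / 2)))" for x
    by (simp add: ennreal_mult'[symmetric] exp_add[symmetric] power2_norm_eq_inner inner_simps inner_commute)
       (simp add: field_simps)
  have "(\<integral>\<^sup>+x. ennreal (exp (- (norm x)\<^sup>2 / 2)) * ennreal (exp (v \<bullet> x)) \<partial>lborel)
    = ennreal (exp ((norm v)\<^sup>2 / 2)) * (\<integral>\<^sup>+x. ennreal (exp (- (norm x)\<^sup>2 / 2)) \<partial>(lborel :: 'a measure))"
    by (subst nn_integral_lborel_affine[of _ 1 v])
       (simp_all add: e nn_integral_cmult)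
  then have "(\<integral>\<^sup>+x. ennreal (exp (v \<bullet> x)) \<partial>std_gauss)
     = ennreal (exp ((norm v)\<^sup>2 / 2)) * (\<integral>\<^sup>+x. 1 \<partial>(std_gauss :: 'a measure))"
    by (simp only: nn_integral_std_gauss borel_measurable_const measurable_compose) 
       (simp add: nn_integral_std_gauss mult_ac del: nn_integral_const)
  then show ?thesis by (simp add: std_gauss.emeasure_space_1[simplified])
qed

text \<open>From \<open>|t| \<le> cosh t / sqrt 2\<close>; the sharp constant would be \<open>sqrt (2 / \<pi>)\<close>.\<close>
definition gauss_abs_bound :: real where "gauss_abs_bound = sqrt (exp 1 / 2)"

lemma gauss_abs_bound_nonneg: "0 \<le> gauss_abs_bound"
  by (simp add: gauss_abs_bound_def)

lemma gauss_abs_bound_le: "gauss_abs_bound \<le> 117 / 100"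
  unfolding gauss_abs_bound_def using e_less_272
  by (intro real_le_lsqrt) (auto simp: power2_eq_square)

text \<open>Domination by cosh reduces the absolute moment to two exponential moments, so the
  one-dimensional marginal of the Gaussian is never computed. For a unit vector \<open>u\<close> the
  mean of cosh (u \<bullet> X) is exp (1/2), and dividing by sqrt 2 gives
  \<open>gauss_abs_bound\<close>.\<close>

lemma nn_integral_std_gauss_abs_inner:
  fixes v :: "'a::euclidean_space"
  shows "(\<integral>\<^sup>+x. ennreal \<bar>v \<bullet> x\<bar> \<partial>std_gauss) \<le> ennreal (gauss_abs_bound * norm v)"
proof (cases "v = 0")
  case False
  define u where "u = v /\<^sub>R norm v"
  have u: "norm u = 1" "v = norm v *\<^sub>R u" using False by (auto simp: u_def)
  have ab: "\<bar>t\<bar> \<le> (exp t + exp (- t)) / (2 * sqrt 2)" for t :: real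
  proof -
    have "1 + t\<^sup>2 / 2 \<le> cosh t"
    proof -
      let ?c = "\<lambda>n. if even n then t ^ n /\<^sub>R fact n else 0"
      \<comment> \<open>Below index 3 only 1 and t^2/2 survive; the omitted even terms are
        nonnegative.\<close>
      have "sum ?c {..<3} \<le> suminf ?c"
        using cosh_converges[of t] by (intro sum_le_suminf) (auto simp: sums_iff)
      then show ?thesis
        using cosh_converges[of t] by (simp add: sums_iff eval_nat_numeral divide_simps)
    qed
    moreover have "sqrt 2 * \<bar>t\<bar> \<le> 1 + t\<^sup>2 / 2"
    proof -
      have "(\<bar>t\<bar> - sqrt 2)\<^sup>2 = t\<^sup>2 + 2 - 2 * (sqrt 2 * \<bar>t\<bar>)" by (simp add: power2_diff)
      then show ?thesis using zero_le_power2[of "\<bar>t\<bar> - sqrt 2"] by linarith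
    qed
    ultimately have "sqrt 2 * \<bar>t\<bar> \<le> cosh t" by simp
    then have "\<bar>t\<bar> \<le> cosh t / sqrt 2" by (simp add: pos_le_divide_eq mult.commute)
    then show ?thesis by (simp add: cosh_def)
  qed
  have "(\<integral>\<^sup>+x. ennreal \<bar>v \<bullet> x\<bar> \<partial>std_gauss)
     \<le> (\<integral>\<^sup>+x. ennreal (norm v / (2 * sqrt 2)) * (ennreal (exp (u \<bullet> x)) + ennreal (exp ((- u) \<bullet> x))) \<partial>std_gauss)"
  proof (intro nn_integral_mono)
    fix x
    have "\<bar>v \<bullet> x\<bar> = norm v * \<bar>u \<bullet> x\<bar>" by (subst u(2)) (simp add: abs_mult)
    also have "\<dots> \<le> norm v * ((exp (u \<bullet> x) + exp (- (u \<bullet> x))) / (2 * sqrt 2))"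
      by (intro mult_left_mono ab) auto
    finally show "ennreal \<bar>v \<bullet> x\<bar> \<le> ennreal (norm v / (2 * sqrt 2)) *
        (ennreal (exp (u \<bullet> x)) + ennreal (exp ((- u) \<bullet> x)))"
      by (simp add: ennreal_mult'[symmetric] ennreal_plus[symmetric] ennreal_leI del: ennreal_plus)
  qed
  also have "\<dots> = ennreal (norm v / (2 * sqrt 2)) * (ennreal (exp (1/2)) + ennreal (exp (1/2)))"
    by (simp add: nn_integral_cmult nn_integral_add nn_integral_std_gauss_exp_inner u(1)
        del: inner_minus_left)
  also have "\<dots> = ennreal (gauss_abs_bound * norm v)"
  proof -
    have "sqrt (exp 1) = exp (1/2 :: real)"
      by (rule real_sqrt_unique) (simp_all add: exp_double[symmetric])
    then show ?thesis
    by (simp add: ennreal_mult'[symmetric] ennreal_plus[symmetric] gauss_abs_bound_def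
        real_sqrt_divide del: ennreal_plus)
  qed
  finally show ?thesis .
qed simp

subsection \<open>A Gaussian \<open>L\<^sup>1\<close> Poincare inequality\<close>

text \<open>The rotation is carried out one variable at a time: for fixed \<open>x\<close> the first
  argument becomes the new variable in place of \<open>y\<close>, then, after exchanging the
  integrals, the second argument replaces \<open>x\<close>. The Jacobians (1/c)^d and c^d cancel;
  the division is the reason for asking c > 0.\<close>

lemma nn_integral_lborel_rotation:
  fixes g :: "'a::euclidean_space \<Rightarrow> 'a \<Rightarrow> ennreal"
  assumes [measurable]: "(\<lambda>(x, y). g x y) \<in> borel_measurable (borel \<Otimes>\<^sub>M borel)"
    and sc: "s\<^sup>2 + c\<^sup>2 = (1::real)" and c: "c > 0"
  shows "(\<integral>\<^sup>+x. \<integral>\<^sup>+y. g (s *\<^sub>R x + c *\<^sub>R y) (c *\<^sub>R x - s *\<^sub>R y) \<partial>lborel \<partial>lborel)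
       = (\<integral>\<^sup>+x. \<integral>\<^sup>+y. g x y \<partial>lborel \<partial>lborel)"
proof -
  have cs: "c + s\<^sup>2 / c = 1 / c"
    using sc c by (simp add: field_simps power2_eq_square)
  have inner: "(\<integral>\<^sup>+y. g (s *\<^sub>R x + c *\<^sub>R y) (c *\<^sub>R x - s *\<^sub>R y) \<partial>lborel)
     = ennreal ((1 / c) ^ DIM('a)) * (\<integral>\<^sup>+u. g u ((1 / c) *\<^sub>R x - (s / c) *\<^sub>R u) \<partial>lborel)" for x
  proof -
    have e: "c *\<^sub>R x - s *\<^sub>R (- (s / c) *\<^sub>R x + (1 / c) *\<^sub>R u) = (1 / c) *\<^sub>R x - (s / c) *\<^sub>R u" for u
    proof -
      have "c *\<^sub>R x - s *\<^sub>R (- (s / c) *\<^sub>R x + (1 / c) *\<^sub>R u) = (c + s\<^sup>2 / c) *\<^sub>R x - (s / c) *\<^sub>R u"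
        by (simp add: algebra_simps power2_eq_square)
      then show ?thesis by (simp add: cs)
    qed
    show ?thesis
      using c by (subst nn_integral_lborel_affine[of _ "1 / c" "- (s / c) *\<^sub>R x"])
        (simp_all only: e, simp_all add: scaleR_diff_right)
  qed
  have "(\<integral>\<^sup>+x. \<integral>\<^sup>+y. g (s *\<^sub>R x + c *\<^sub>R y) (c *\<^sub>R x - s *\<^sub>R y) \<partial>lborel \<partial>lborel)
    = ennreal ((1 / c) ^ DIM('a)) *
      (\<integral>\<^sup>+x. \<integral>\<^sup>+u. g u ((1 / c) *\<^sub>R x - (s / c) *\<^sub>R u) \<partial>lborel \<partial>lborel)"
    by (simp add: inner nn_integral_cmult)
  also have "(\<integral>\<^sup>+x. \<integral>\<^sup>+u. g u ((1 / c) *\<^sub>R x - (s / c) *\<^sub>R u) \<partial>lborel \<partial>lborel)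
     = (\<integral>\<^sup>+u. \<integral>\<^sup>+x. g u ((1 / c) *\<^sub>R x - (s / c) *\<^sub>R u) \<partial>lborel \<partial>lborel)"
    by (rule lborel_pair.Fubini') simp
  also have "\<dots> = (\<integral>\<^sup>+u. ennreal (c ^ DIM('a)) * (\<integral>\<^sup>+w. g u w \<partial>lborel) \<partial>lborel)"
  proof (rule nn_integral_cong)
    fix u :: 'a
    show "(\<integral>\<^sup>+x. g u ((1 / c) *\<^sub>R x - (s / c) *\<^sub>R u) \<partial>lborel)
      = ennreal (c ^ DIM('a)) * (\<integral>\<^sup>+w. g u w \<partial>lborel)"
      using c by (subst nn_integral_lborel_affine[of _ c "s *\<^sub>R u"]) (simp_all add: scaleR_add_right)
  qed
  also have "ennreal ((1 / c) ^ DIM('a)) * \<dots> = (\<integral>\<^sup>+x. \<integral>\<^sup>+y. g x y \<partial>lborel \<partial>lborel)"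
    using c by (simp add: nn_integral_cmult mult.assoc[symmetric] ennreal_mult'[symmetric]
        power_mult_distrib[symmetric])
  finally show ?thesis .
qed

lemma nn_integral_std_gauss_rotation:
  fixes h :: "'a::euclidean_space \<Rightarrow> 'a \<Rightarrow> ennreal"
  assumes [measurable]: "(\<lambda>(x, y). h x y) \<in> borel_measurable (borel \<Otimes>\<^sub>M borel)"
    and sc: "s\<^sup>2 + c\<^sup>2 = (1::real)" and c: "c > 0"
  shows "(\<integral>\<^sup>+x. \<integral>\<^sup>+y. h (s *\<^sub>R x + c *\<^sub>R y) (c *\<^sub>R x - s *\<^sub>R y) \<partial>std_gauss \<partial>std_gauss)
       = (\<integral>\<^sup>+x. \<integral>\<^sup>+y. h x y \<partial>std_gauss \<partial>std_gauss)"
proof -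
  define w where "w x y = ennreal (exp (- (norm x)\<^sup>2 / 2)) * ennreal (exp (- (norm y)\<^sup>2 / 2))" for x y :: 'a
  have [measurable]: "(\<lambda>(x, y). w x y) \<in> borel_measurable (borel \<Otimes>\<^sub>M borel)"
    unfolding w_def by measurable
  define g where "g x y = w x y * h x y" for x y
  have [measurable]: "(\<lambda>(x, y). g x y) \<in> borel_measurable (borel \<Otimes>\<^sub>M borel)"
    unfolding g_def by measurable
  define C where "C = ennreal (1 / sqrt (2 * pi) ^ DIM('a))"
  have iter: "(\<integral>\<^sup>+x. \<integral>\<^sup>+y. k x y \<partial>std_gauss \<partial>std_gauss)
      = C * C * (\<integral>\<^sup>+x. \<integral>\<^sup>+y. w x y * k x y \<partial>lborel \<partial>lborel)"
    if [measurable]: "(\<lambda>(x, y). k x y) \<in> borel_measurable (borel \<Otimes>\<^sub>M borel)" for k :: "'a \<Rightarrow> 'a \<Rightarrow> ennreal"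
    unfolding w_def
    by (simp add: nn_integral_std_gauss C_def nn_integral_cmult[symmetric] mult_ac)
  have w: "w (s *\<^sub>R x + c *\<^sub>R y) (c *\<^sub>R x - s *\<^sub>R y) = w x y" for x y
  proof -
    have "(norm (s *\<^sub>R x + c *\<^sub>R y))\<^sup>2 + (norm (c *\<^sub>R x - s *\<^sub>R y))\<^sup>2
       = (s\<^sup>2 + c\<^sup>2) * ((norm x)\<^sup>2 + (norm y)\<^sup>2)"
      by (simp only: power2_norm_eq_inner)
        (simp add: inner_simps inner_commute[of y x] algebra_simps power2_eq_square
          del: dot_square_norm)
    then show ?thesis
      by (simp add: w_def ennreal_mult'[symmetric] exp_add[symmetric] sc add_divide_distrib[symmetric])
  qed
  have "(\<integral>\<^sup>+x. \<integral>\<^sup>+y. h (s *\<^sub>R x + c *\<^sub>R y) (c *\<^sub>R x - s *\<^sub>R y) \<partial>std_gauss \<partial>std_gauss)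
    = C * C * (\<integral>\<^sup>+x. \<integral>\<^sup>+y. g (s *\<^sub>R x + c *\<^sub>R y) (c *\<^sub>R x - s *\<^sub>R y) \<partial>lborel \<partial>lborel)"
    by (subst iter) (simp_all add: g_def w)
  also have "\<dots> = C * C * (\<integral>\<^sup>+x. \<integral>\<^sup>+y. g x y \<partial>lborel \<partial>lborel)"
    by (subst nn_integral_lborel_rotation[OF _ sc c]) simp_all
  also have "\<dots> = (\<integral>\<^sup>+x. \<integral>\<^sup>+y. h x y \<partial>std_gauss \<partial>std_gauss)"
    by (subst iter) (simp_all add: g_def[abs_def])
  finally show ?thesis .
qed

text \<open>Along the quarter turn from \<open>y\<close> to \<open>x\<close> the velocity at angle t
  is the second vector of the rotated pair, so the integrand depends on the rotated pair
  alone.\<close>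

lemma rotation_path_bound:
  fixes F :: "'a::euclidean_space \<Rightarrow> real"
  assumes F: "\<And>x. (F has_derivative (\<lambda>h. G x \<bullet> h)) (at x)"
    and G: "continuous_on UNIV G"
  shows "ennreal \<bar>F x - F y\<bar> \<le> (\<integral>\<^sup>+t. ennreal \<bar>G (sin t *\<^sub>R x + cos t *\<^sub>R y) \<bullet> (cos t *\<^sub>R x - sin t *\<^sub>R y)\<bar>
            * indicator {0<..<pi / 2} t \<partial>lborel)"
proof -
  define k where "k t = G (sin t *\<^sub>R x + cos t *\<^sub>R y) \<bullet> (cos t *\<^sub>R x - sin t *\<^sub>R y)" for t
  have kc: "continuous_on A k" for A
    unfolding k_def by (intro continuous_intros continuous_on_compose2[OF G]) auto
  have der: "((\<lambda>t. F (sin t *\<^sub>R x + cos t *\<^sub>R y)) has_real_derivative k t) (at t within A)" for t A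
  proof -
    have p: "((\<lambda>t. sin t *\<^sub>R x + cos t *\<^sub>R y) has_derivative (\<lambda>h. h *\<^sub>R (cos t *\<^sub>R x - sin t *\<^sub>R y))) (at t within A)"
      by (auto intro!: derivative_eq_intros simp: algebra_simps)
    show ?thesis
      using has_derivative_compose[OF p F] unfolding has_field_derivative_def k_def
      by (rule has_derivative_eq_rhs) (simp add: fun_eq_iff)
  qed
  have FTC: "has_bochner_integral lborel (\<lambda>t. indicator {0..pi/2} t *\<^sub>R k t) (F x - F y)"
    using has_bochner_integral_FTC_Icc[of 0 "pi/2" "\<lambda>t. F (sin t *\<^sub>R x + cos t *\<^sub>R y)" k] der kc
    by (simp add: has_real_derivative_iff_has_vector_derivative)
  then have "\<bar>F x - F y\<bar> \<le> (\<integral>t. \<bar>indicator {0..pi/2} t *\<^sub>R k t\<bar> \<partial>lborel)"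
    using integral_abs_bound[of lborel "\<lambda>t. indicator {0..pi/2} t *\<^sub>R k t"]
    by (simp add: has_bochner_integral_iff)
  also have "ennreal \<dots> = (\<integral>\<^sup>+t. ennreal \<bar>indicator {0..pi/2} t *\<^sub>R k t\<bar> \<partial>lborel)"
    using FTC by (intro nn_integral_eq_integral[symmetric]) (auto simp: has_bochner_integral_iff)
  \<comment> \<open>The endpoints form a null set; without them cos t > 0 holds throughout, as the
    rotation substitution requires.\<close>
  also have "\<dots> = (\<integral>\<^sup>+t. ennreal \<bar>k t\<bar> * indicator {0<..<pi/2} t \<partial>lborel)"
  proof (rule nn_integral_cong_AE)
    have "AE t in lborel. t \<noteq> 0 \<and> t \<noteq> pi/2"
      using AE_lborel_singleton[of "0::real"] AE_lborel_singleton[of "pi/2"] by eventually_elim auto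
    then show "AE t in lborel. ennreal \<bar>indicator {0..pi/2} t *\<^sub>R k t\<bar> = ennreal \<bar>k t\<bar> * indicator {0<..<pi/2} t"
      by eventually_elim (auto split: split_indicator)
  qed
  finally show ?thesis by (simp add: ennreal_leI k_def)
qed

text \<open>The Maurey--Pisier argument: \<open>(X, Y)\<close> and its rotation by the angle \<open>t\<close> have the same law.\<close>
lemma std_gauss_L1_poincare:
  fixes F :: "'a::euclidean_space \<Rightarrow> real"
  assumes F: "\<And>x. (F has_derivative (\<lambda>h. G x \<bullet> h)) (at x)"
    and G: "continuous_on UNIV G"
  shows "(\<integral>\<^sup>+x. \<integral>\<^sup>+y. ennreal \<bar>F x - F y\<bar> \<partial>std_gauss \<partial>std_gauss)
     \<le> ennreal (pi / 2 * gauss_abs_bound) * (\<integral>\<^sup>+x. ennreal (norm (G x)) \<partial>std_gauss)"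
proof -
  have [measurable]: "G \<in> borel_measurable borel"
    using G by (rule borel_measurable_continuous_onI)
  define h where "h x y = ennreal \<bar>G x \<bullet> y\<bar>" for x y
  have [measurable]: "(\<lambda>(x, y). h x y) \<in> borel_measurable (borel \<Otimes>\<^sub>M borel)"
    unfolding h_def by measurable
  interpret P2: pair_sigma_finite "std_gauss :: 'a measure" "lborel :: real measure" ..
  define k where "k t x y = h (sin t *\<^sub>R x + cos t *\<^sub>R y) (cos t *\<^sub>R x - sin t *\<^sub>R y)
      * indicator {0<..<pi / 2} t" for t :: real and x y :: 'a
  have [measurable]: "(\<lambda>(t, x, y). k t x y) \<in> borel_measurable (borel \<Otimes>\<^sub>M borel \<Otimes>\<^sub>M borel)"
    unfolding k_def by measurable
  have "(\<integral>\<^sup>+x. \<integral>\<^sup>+y. ennreal \<bar>F x - F y\<bar> \<partial>std_gauss \<partial>std_gauss)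
    \<le> (\<integral>\<^sup>+x. \<integral>\<^sup>+y. \<integral>\<^sup>+t. k t x y \<partial>lborel \<partial>std_gauss \<partial>std_gauss)"
    unfolding k_def h_def by (intro nn_integral_mono rotation_path_bound[OF F G])
  also have "\<dots> = (\<integral>\<^sup>+x. \<integral>\<^sup>+t. \<integral>\<^sup>+y. k t x y \<partial>std_gauss \<partial>lborel \<partial>std_gauss)"
    by (intro nn_integral_cong P2.Fubini'[symmetric]) (unfold k_def, measurable)
  also have "\<dots> = (\<integral>\<^sup>+t. \<integral>\<^sup>+x. \<integral>\<^sup>+y. k t x y \<partial>std_gauss \<partial>std_gauss \<partial>lborel)"
    by (intro P2.Fubini'[symmetric]) (unfold k_def, measurable)
  also have "\<dots> = (\<integral>\<^sup>+t. (\<integral>\<^sup>+x. \<integral>\<^sup>+y. h x y \<partial>std_gauss \<partial>std_gauss) * indicator {0<..<pi/2} t \<partial>lborel)"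
  proof (rule nn_integral_cong)
    fix t :: real
    show "(\<integral>\<^sup>+x. \<integral>\<^sup>+y. k t x y \<partial>std_gauss \<partial>std_gauss)
       = (\<integral>\<^sup>+x. \<integral>\<^sup>+y. h x y \<partial>std_gauss \<partial>std_gauss) * indicator {0<..<pi/2} t"
    proof (cases "t \<in> {0<..<pi/2}")
      case True
      then have "cos t > 0" by (intro cos_gt_zero_pi) auto
      with True show ?thesis
        using nn_integral_std_gauss_rotation[of h "sin t" "cos t"] by (simp add: k_def)
    qed (simp add: k_def)
  qed
  also have "\<dots> = ennreal (pi / 2) * (\<integral>\<^sup>+x. \<integral>\<^sup>+y. h x y \<partial>std_gauss \<partial>std_gauss)"
    by (simp add: nn_integral_cmult_indicator mult.commute)
  \<comment> \<open>After the rotation the gradient and the direction sit at independent variables: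
    for fixed \<open>x\<close> the inner integral is the mean of |G x \<bullet> Y|.\<close>
  also have "\<dots> \<le> ennreal (pi / 2) * (\<integral>\<^sup>+x. ennreal (gauss_abs_bound * norm (G x)) \<partial>std_gauss)"
    unfolding h_def by (intro mult_left_mono nn_integral_mono nn_integral_std_gauss_abs_inner) auto
  also have "\<dots> = ennreal (pi / 2) * (ennreal gauss_abs_bound * (\<integral>\<^sup>+x. ennreal (norm (G x)) \<partial>std_gauss))"
    using gauss_abs_bound_nonneg by (simp add: ennreal_mult' nn_integral_cmult)
  also have "\<dots> = ennreal (pi / 2 * gauss_abs_bound) * (\<integral>\<^sup>+x. ennreal (norm (G x)) \<partial>std_gauss)"
    by (subst ennreal_mult'[of "pi / 2"]) (simp_all only: mult.assoc pi_half_ge_zero)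
  finally show ?thesis .
qed

subsection \<open>Comparison in normalised coordinates\<close>

definition sq_pos :: "real \<Rightarrow> real" where "sq_pos u = (max 0 u)\<^sup>2"

lemma DERIV_sq_pos: "(sq_pos has_real_derivative 2 * max 0 u) (at u)"
proof (cases "u = 0")
  case True
  have "((\<lambda>h. sq_pos h / h) \<longlongrightarrow> 0) (at 0)"
  proof (rule Lim_null_comparison)
    show "\<forall>\<^sub>F h in at 0. norm (sq_pos h / h) \<le> \<bar>h\<bar>"
      by (intro always_eventually allI) (auto simp: sq_pos_def max_def power2_eq_square)
    show "((\<lambda>h::real. \<bar>h\<bar>) \<longlongrightarrow> 0) (at 0)" by (auto intro!: tendsto_eq_intros)
  qed
  with True show ?thesis by (simp add: DERIV_def sq_pos_def)
next
  case False
  then consider "u > 0" | "u < 0" by linarith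
  then show ?thesis
  proof cases
    case 1
    have "((\<lambda>u. u\<^sup>2) has_real_derivative 2 * max 0 u) (at u)"
      using 1 by (auto intro!: derivative_eq_intros)
    then show ?thesis
      by (rule has_field_derivative_transform_within_open[of _ _ _ "{0<..}"])
         (use 1 in \<open>auto simp: sq_pos_def\<close>)
  next
    case 2
    have "((\<lambda>u. 0) has_real_derivative 2 * max 0 u) (at u)" using 2 by simp
    then show ?thesis
      by (rule has_field_derivative_transform_within_open[of _ _ _ "{..<0}"])
         (use 2 in \<open>auto simp: sq_pos_def\<close>)
  qed
qed

text \<open>A monotone \<open>C\<^sup>1\<close> step from \<open>0\<close> on \<open>{..0}\<close> to \<open>1\<close> on \<open>{1..}\<close>.\<close>
definition step :: "real \<Rightarrow> real" where "step u = 1 - sq_pos (1 - sq_pos u)"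

definition step' :: "real \<Rightarrow> real" where "step' u = 4 * max 0 (1 - sq_pos u) * max 0 u"

lemma DERIV_step: "(step has_real_derivative step' u) (at u)"
  unfolding step_def step'_def
  by (auto intro!: derivative_eq_intros DERIV_chain2[OF DERIV_sq_pos] DERIV_sq_pos)

lemma continuous_step': "continuous_on A step'"
  unfolding step'_def sq_pos_def by (intro continuous_intros)

lemma sq_pos_mono: "u \<le> w \<Longrightarrow> sq_pos u \<le> sq_pos w"
  unfolding sq_pos_def by (intro power_mono) auto

lemma step_mono: "u \<le> w \<Longrightarrow> step u \<le> step w"
  unfolding step_def by (simp add: sq_pos_mono)

lemma step_eq_1: "1 \<le> u \<Longrightarrow> step u = 1"
  and step_eq_0: "u \<le> 0 \<Longrightarrow> step u = 0"
  by (auto simp: step_def sq_pos_def max_def abs_square_le_1 dest: power_mono[of 1 u 2])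

lemma step_nonneg: "0 \<le> step u" and step_le_1: "step u \<le> 1"
proof -
  have "sq_pos (1 - sq_pos u) \<le> sq_pos 1" by (rule sq_pos_mono) (simp add: sq_pos_def)
  then show "0 \<le> step u" by (simp add: step_def sq_pos_def)
  show "step u \<le> 1" by (simp add: step_def sq_pos_def)
qed

lemma step'_eq_0: "1 \<le> u \<Longrightarrow> step' u = 0"
  by (auto simp: step'_def sq_pos_def max_def dest: power_mono[of 1 u 2])

lemma step'_bounds: "0 \<le> step' u" "step' u \<le> 2"
proof -
  show "0 \<le> step' u" by (simp add: step'_def)
  show "step' u \<le> 2"
  proof (cases "0 \<le> u \<and> u \<le> 1")
    case True
    \<comment> \<open>A certificate for nonnegativity of the cubic 2 - 4 u + 4 u^3 on the unit
      interval. The true maximum of \<open>step'\<close> is 8 / (3 sqrt 3); the rounder value 2 is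
      good enough.\<close>
    have "0 \<le> 4 * (u + 1) * (u - 1/2)\<^sup>2 + (1 - u)" using True by simp
    also have "\<dots> = 2 - 4 * (1 - u\<^sup>2) * u" by (simp add: power2_eq_square algebra_simps)
    finally show ?thesis using True by (simp add: step'_def sq_pos_def abs_square_le_1)
  next
    case False
    then show ?thesis using step'_eq_0[of u] by (cases "u \<le> 0") (auto simp: step'_def)
  qed
qed

text \<open>Writing the indicator of \<open>B\<close> through the sign \<open>s\<close>, which is 1
  on \<open>B\<close> and -1 off it, turns twice the covariance into the mean of (F - m) s; this
  gains the factor 2. The centring \<open>m\<close> is then replaced by an independent copy by
  averaging over \<open>y\<close>.\<close>

lemma (in prob_space) abs_covariance_indicator_le:
  fixes F :: "'a \<Rightarrow> real"
  assumes F: "integrable M F" and B: "B \<in> sets M"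
  shows "ennreal (2 * \<bar>(\<integral>x. F x * indicator B x \<partial>M) - expectation F * prob B\<bar>)
    \<le> (\<integral>\<^sup>+x. \<integral>\<^sup>+y. ennreal \<bar>F x - F y\<bar> \<partial>M \<partial>M)"
proof -
  define m where "m = expectation F"
  define s where "s x = (2 * indicator B x - 1 :: real)" for x
  have [measurable]: "F \<in> borel_measurable M" "B \<in> sets M" using F B by auto
  have i: "integrable M (\<lambda>x. F x * indicator B x)" "integrable M (\<lambda>x. indicator B x :: real)"
    using F B by (auto intro!: integrable_real_mult_indicator simp: emeasure_eq_measure)
  have "2 * ((\<integral>x. F x * indicator B x \<partial>M) - m * prob B) = (\<integral>x. (F x - m) * s x \<partial>M)"
  proof -
    have "(\<integral>x. (F x - m) * s x \<partial>M) = (\<integral>x. 2 * (F x * indicator B x) - 2 * m * indicator B x - F x + m \<partial>M)"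
      by (intro Bochner_Integration.integral_cong) (auto simp: s_def algebra_simps)
    also have "\<dots> = 2 * (\<integral>x. F x * indicator B x \<partial>M) - 2 * m * prob B - m + m"
      using F B i by (simp add: prob_space m_def)
    finally show ?thesis by simp
  qed
  then have "2 * \<bar>(\<integral>x. F x * indicator B x \<partial>M) - m * prob B\<bar> = \<bar>\<integral>x. (F x - m) * s x \<partial>M\<bar>"
    by (metis abs_mult abs_numeral)
  also have "\<dots> \<le> (\<integral>x. \<bar>(F x - m) * s x\<bar> \<partial>M)" by (rule integral_abs_bound)
  also have "\<dots> = (\<integral>x. \<bar>F x - m\<bar> \<partial>M)"
    by (intro Bochner_Integration.integral_cong) (auto simp: s_def split: split_indicator)
  also have "ennreal \<dots> = (\<integral>\<^sup>+x. ennreal \<bar>F x - m\<bar> \<partial>M)"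
    using F by (intro nn_integral_eq_integral[symmetric]) auto
  also have "\<dots> \<le> (\<integral>\<^sup>+x. \<integral>\<^sup>+y. ennreal \<bar>F x - F y\<bar> \<partial>M \<partial>M)"
  proof (intro nn_integral_mono)
    fix x
    have "F x - m = (\<integral>y. F x - F y \<partial>M)" using F by (simp add: m_def prob_space)
    then have "\<bar>F x - m\<bar> \<le> (\<integral>y. \<bar>F x - F y\<bar> \<partial>M)"
      using integral_abs_bound[of M "\<lambda>y. F x - F y"] by simp
    also have "ennreal \<dots> = (\<integral>\<^sup>+y. ennreal \<bar>F x - F y\<bar> \<partial>M)"
      using F by (intro nn_integral_eq_integral[symmetric]) auto
    finally show "ennreal \<bar>F x - m\<bar> \<le> (\<integral>\<^sup>+y. ennreal \<bar>F x - F y\<bar> \<partial>M)" by (simp add: ennreal_leI)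
  qed
  finally show ?thesis by (simp add: ennreal_leI m_def)
qed

text \<open>Follows from (1 - y + y^2/2) (1 + y + y^2/2) = 1 + y^4/4 and the quadratic Taylor bound
  for exp y.\<close>

lemma exp_minus_le_quadratic: "0 \<le> y \<Longrightarrow> exp (- y) \<le> 1 - y + y\<^sup>2 / 2" for y :: real
proof -
  assume y: "0 \<le> y"
  have pos: "0 < 1 - y + y\<^sup>2 / 2" using zero_le_power2[of "y - 1"] by (simp add: power2_diff)
  have "1 \<le> 1 + y ^ 4 / 4" by simp
  also have "\<dots> = (1 - y + y\<^sup>2 / 2) * (1 + y + y\<^sup>2 / 2)"
    by (simp add: power2_eq_square power4_eq_xxxx algebra_simps)
  also have "\<dots> \<le> (1 - y + y\<^sup>2 / 2) * exp y"
    using exp_lower_Taylor_quadratic[OF y] pos by (intro mult_left_mono) auto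
  finally show ?thesis by (simp add: exp_minus field_simps)
qed

text \<open>The problem after whitening. Derivatives are controlled only in the ball; beyond it,
  convexity on the open set \<open>\<Omega>\<close> supplies both the growth of \<open>V\<close> and
  its continuity, hence measurability.\<close>

locale near_gaussian =
  fixes \<Omega> :: "'a::euclidean_space set" and V :: "'a \<Rightarrow> real" and v :: "'a \<Rightarrow> 'a" and R L r :: real
  assumes open_\<Omega>: "open \<Omega>" and convex_V: "convex_on \<Omega> V" and V0: "V 0 = 0"
    and ball_\<Omega>: "ball 0 R \<subseteq> \<Omega>"
    and der: "\<And>x. norm x < R \<Longrightarrow> (V has_derivative (\<lambda>h. v x \<bullet> h)) (at x)"
    and cont_v: "continuous_on (ball 0 R) v"
    and near: "\<And>x. norm x < R \<Longrightarrow> norm (v x - x) \<le> L / 2 * (norm x)\<^sup>2"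
    and L_nonneg: "0 \<le> L" and LR: "L * R \<le> 1 / 2"
    and R_eq: "R = r * sqrt (DIM('a))" and r_ge: "6 \<le> r"
begin

section \<open>Growth of the potential along rays\<close>

definition "R0 = 5 / 6 * R"

lemma R_ge: "6 \<le> R"
proof -
  have "1 \<le> sqrt (DIM('a))" by (simp add: Suc_leI)
  then have "6 * 1 \<le> r * sqrt (DIM('a))" using r_ge by (intro mult_mono) auto
  then show ?thesis by (simp add: R_eq)
qed

lemma R0: "0 < R0" "R0 < R" "5 \<le> R0" using R_ge by (auto simp: R0_def)

text \<open>Here \<open>LR\<close> enters: inside the ball the error L/2 |tx|^2 is at most a quarter
  of |tx|, which yields the factors 3/4 and 5/4.\<close>

lemma radial_derivative:
  assumes "0 \<le> t" "norm (t *\<^sub>R x) < R"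
  shows "3 / 4 * t * (norm x)\<^sup>2 \<le> v (t *\<^sub>R x) \<bullet> x" "v (t *\<^sub>R x) \<bullet> x \<le> 5 / 4 * t * (norm x)\<^sup>2"
proof -
  define k where "k = t * (norm x)\<^sup>2"
  have "\<bar>(v (t *\<^sub>R x) - t *\<^sub>R x) \<bullet> x\<bar> \<le> norm (v (t *\<^sub>R x) - t *\<^sub>R x) * norm x"
    by (rule Cauchy_Schwarz_ineq2)
  also have "\<dots> \<le> L / 2 * (norm (t *\<^sub>R x))\<^sup>2 * norm x"
    by (intro mult_right_mono near assms) auto
  also have "\<dots> = (L * norm (t *\<^sub>R x)) * (t / 2 * (norm x)\<^sup>2)"
    using assms(1) by (simp add: power2_eq_square)
  also have "\<dots> \<le> (1 / 2) * (t / 2 * (norm x)\<^sup>2)"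
  proof (rule mult_right_mono)
    have "L * norm (t *\<^sub>R x) \<le> L * R" using assms L_nonneg by (intro mult_left_mono) auto
    then show "L * norm (t *\<^sub>R x) \<le> 1 / 2" using LR by simp
  qed (use assms in simp)
  finally have "\<bar>v (t *\<^sub>R x) \<bullet> x - k\<bar> \<le> k / 4"
    by (simp add: inner_diff_left power2_norm_eq_inner k_def)
  then have "3 / 4 * k \<le> v (t *\<^sub>R x) \<bullet> x" "v (t *\<^sub>R x) \<bullet> x \<le> 5 / 4 * k" by linarith+
  then show "3 / 4 * t * (norm x)\<^sup>2 \<le> v (t *\<^sub>R x) \<bullet> x" "v (t *\<^sub>R x) \<bullet> x \<le> 5 / 4 * t * (norm x)\<^sup>2"
    by (simp_all add: k_def mult.assoc)
qed

text \<open>Integrates the radial derivative between two points of a ray. The start \<open>a\<close>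
  is kept general because the comparison with a dilation takes a = 1, whereas the plain bounds on
  \<open>V\<close> take a = 0.\<close>

lemma radial_growth:
  assumes ab: "0 \<le> a" "a \<le> b" "norm (b *\<^sub>R x) < R"
  shows "3 / 8 * (b\<^sup>2 - a\<^sup>2) * (norm x)\<^sup>2 \<le> V (b *\<^sub>R x) - V (a *\<^sub>R x)"
    "V (b *\<^sub>R x) - V (a *\<^sub>R x) \<le> 5 / 8 * (b\<^sup>2 - a\<^sup>2) * (norm x)\<^sup>2"
proof -
  have t: "norm (t *\<^sub>R x) < R" if "a \<le> t" "t \<le> b" for t
  proof -
    have "t * norm x \<le> b * norm x" using that by (intro mult_right_mono) auto
    then show ?thesis using that ab by simp
  qed
  have d: "((\<lambda>t. V (t *\<^sub>R x)) has_real_derivative v (t *\<^sub>R x) \<bullet> x) (at t)" if "a \<le> t" "t \<le> b" for t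
  proof -
    have "((\<lambda>t. t *\<^sub>R x) has_derivative (\<lambda>h. h *\<^sub>R x)) (at t)"
      by (auto intro!: derivative_eq_intros)
    from has_derivative_compose[OF this der[OF t[OF that]]]
    show ?thesis unfolding has_field_derivative_def
      by (rule has_derivative_eq_rhs) (simp add: fun_eq_iff)
  qed
  have "V (a *\<^sub>R x) - 3 / 8 * a\<^sup>2 * (norm x)\<^sup>2 \<le> V (b *\<^sub>R x) - 3 / 8 * b\<^sup>2 * (norm x)\<^sup>2"
  proof (rule DERIV_nonneg_imp_nondecreasing[OF ab(2)])
    fix s assume s: "a \<le> s" "s \<le> b"
    show "\<exists>y. ((\<lambda>t. V (t *\<^sub>R x) - 3 / 8 * t\<^sup>2 * (norm x)\<^sup>2) has_real_derivative y) (at s) \<and> 0 \<le> y"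
      by (intro exI[of _ "v (s *\<^sub>R x) \<bullet> x - 3 / 4 * s * (norm x)\<^sup>2"] conjI)
        (use radial_derivative[of s x] t[OF s] s ab in \<open>auto intro!: derivative_eq_intros d\<close>)
  qed
  then show "3 / 8 * (b\<^sup>2 - a\<^sup>2) * (norm x)\<^sup>2 \<le> V (b *\<^sub>R x) - V (a *\<^sub>R x)"
    by (simp add: algebra_simps)
  have "5 / 8 * a\<^sup>2 * (norm x)\<^sup>2 - V (a *\<^sub>R x) \<le> 5 / 8 * b\<^sup>2 * (norm x)\<^sup>2 - V (b *\<^sub>R x)"
  proof (rule DERIV_nonneg_imp_nondecreasing[OF ab(2)])
    fix s assume s: "a \<le> s" "s \<le> b"
    show "\<exists>y. ((\<lambda>t. 5 / 8 * t\<^sup>2 * (norm x)\<^sup>2 - V (t *\<^sub>R x)) has_real_derivative y) (at s) \<and> 0 \<le> y"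
      by (intro exI[of _ "5 / 4 * s * (norm x)\<^sup>2 - v (s *\<^sub>R x) \<bullet> x"] conjI)
        (use radial_derivative[of s x] t[OF s] s ab in \<open>auto intro!: derivative_eq_intros d\<close>)
  qed
  then show "V (b *\<^sub>R x) - V (a *\<^sub>R x) \<le> 5 / 8 * (b\<^sup>2 - a\<^sup>2) * (norm x)\<^sup>2"
    by (simp add: algebra_simps)
qed

lemma V_bounds:
  assumes "norm x < R"
  shows "3 / 8 * (norm x)\<^sup>2 \<le> V x" "V x \<le> 5 / 8 * (norm x)\<^sup>2"
  using radial_growth[of 0 1 x] assms by (simp_all add: V0)

text \<open>On the segment from 0 to \<open>x\<close> the point of norm \<open>R0\<close> still
  obeys the quadratic lower bound; convexity with V 0 = 0 propagates it outwards as linear growth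
  with slope 3/8 R0.\<close>

lemma V_outer:
  assumes x: "x \<in> \<Omega>" "R0 \<le> norm x"
  shows "3 / 8 * R0 * norm x \<le> V x"
proof -
  define c where "c = R0 / norm x"
  have nx: "norm x > 0" using x R0 by linarith
  have c: "0 < c" "c \<le> 1" using x R0 nx by (auto simp: c_def)
  have n: "norm (c *\<^sub>R x) = R0" using nx R0 by (simp add: c_def)
  have "0 \<in> \<Omega>" using ball_\<Omega> R_ge by auto
  then have "V (c *\<^sub>R x + (1 - c) *\<^sub>R 0) \<le> c * V x + (1 - c) * V 0"
    using convex_V x(1) c unfolding convex_on_def by (auto simp del: scaleR_zero_right)
  then have "V (c *\<^sub>R x) \<le> R0 * V x / norm x" by (simp add: V0 c_def)
  moreover have "3 / 8 * R0\<^sup>2 \<le> V (c *\<^sub>R x)" using V_bounds(1)[of "c *\<^sub>R x"] n R0 by simp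
  ultimately have "3 / 8 * R0\<^sup>2 \<le> R0 * V x / norm x" by linarith
  then have "R0 * (3 / 8 * R0 * norm x) \<le> R0 * V x" using nx by (simp add: field_simps power2_eq_square)
  then show ?thesis using R0 by simp
qed

text \<open>Quadratic in the norm, hence smooth at the origin. The coefficients give the value 1 at
  norm \<open>R0\<close> and -1/10 at norm \<open>R\<close>: being strictly negative on the sphere,
  the argument stays negative on an open set containing the complement of the open ball, and there
  the cutoff vanishes.\<close>

definition cut_arg :: "'a \<Rightarrow> real" where "cut_arg x = 7 / 2 - 18 / (5 * R\<^sup>2) * (norm x)\<^sup>2"

lemma cut_arg_ge_1: "norm x \<le> R0 \<Longrightarrow> 1 \<le> cut_arg x"
proof -
  assume "norm x \<le> R0"
  then have "(norm x)\<^sup>2 \<le> (5 / 6 * R)\<^sup>2" unfolding R0_def by (intro power_mono) auto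
  then show ?thesis using R_ge by (simp add: cut_arg_def power2_eq_square divide_simps)
qed

lemma cut_arg_neg: "R \<le> norm x \<Longrightarrow> cut_arg x < 0"
proof -
  assume "R \<le> norm x"
  then have "18 / (5 * R\<^sup>2) * R\<^sup>2 \<le> 18 / (5 * R\<^sup>2) * (norm x)\<^sup>2"
    using R_ge by (intro mult_left_mono power_mono) auto
  moreover have "18 / (5 * R\<^sup>2) * R\<^sup>2 = 18 / 5" using R_ge by simp
  ultimately show ?thesis by (simp add: cut_arg_def)
qed

lemma cut_arg_antimono: "norm x \<le> norm y \<Longrightarrow> cut_arg y \<le> cut_arg x"
  unfolding cut_arg_def by (intro diff_left_mono mult_left_mono power_mono) auto

lemma continuous_cut_arg: "continuous_on A cut_arg"
  unfolding cut_arg_def using R_ge by (intro continuous_intros) auto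

definition F :: "'a \<Rightarrow> real" where
  "F x = (if norm x < R then step (cut_arg x) * exp ((norm x)\<^sup>2 / 2 - V x) else 0)"

definition grad_F :: "'a \<Rightarrow> 'a" where
  "grad_F x = (if norm x < R then exp ((norm x)\<^sup>2 / 2 - V x) *\<^sub>R
     (step (cut_arg x) *\<^sub>R (x - v x) - (step' (cut_arg x) * (36 / 5) / R\<^sup>2) *\<^sub>R x) else 0)"

text \<open>The open ball and the open set where \<open>cut_arg\<close> is negative cover the space,
  and on the latter \<open>F\<close> is identically 0. So the two branches glue with no analysis on
  the sphere; \<open>continuous_grad_F\<close> uses the same cover.\<close>

lemma has_derivative_F: "(F has_derivative (\<lambda>h. grad_F x \<bullet> h)) (at x)"
proof (cases "norm x < R")
  case True
  have sq: "((\<lambda>x. (norm x)\<^sup>2) has_derivative (\<lambda>h. 2 * (x \<bullet> h))) (at x)"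
    unfolding power2_norm_eq_inner by (auto intro!: derivative_eq_intros simp: inner_commute)
  have c: "(cut_arg has_derivative (\<lambda>h. - (36 / 5) * (x \<bullet> h) / R\<^sup>2)) (at x)"
    unfolding cut_arg_def[abs_def] by (rule derivative_eq_intros sq refl)+ simp
  have st: "((\<lambda>x. step (cut_arg x)) has_derivative (\<lambda>h. step' (cut_arg x) * (- (36 / 5) * (x \<bullet> h) / R\<^sup>2))) (at x)"
    using has_derivative_compose[OF c DERIV_step[unfolded has_field_derivative_def]] .
  have "((\<lambda>x. (norm x)\<^sup>2 / 2 - V x) has_derivative (\<lambda>h. x \<bullet> h - v x \<bullet> h)) (at x)"
    using has_derivative_diff[OF has_derivative_mult_right[OF sq, of "1/2"] der[OF True]] by simp
  note e = has_derivative_exp[OF this]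
  have "((\<lambda>x. step (cut_arg x) * exp ((norm x)\<^sup>2 / 2 - V x)) has_derivative (\<lambda>h. grad_F x \<bullet> h)) (at x)"
    using has_derivative_mult[OF st e]
    by (rule has_derivative_eq_rhs)
      (use True in \<open>simp add: grad_F_def fun_eq_iff inner_simps algebra_simps\<close>)
  then show ?thesis
    by (rule has_derivative_transform_within_open[of _ _ _ _ "ball 0 R"])
      (use True in \<open>auto simp: F_def\<close>)
next
  case False
  have "((\<lambda>x. 0 :: real) has_derivative (\<lambda>h. grad_F x \<bullet> h)) (at x)"
    using False by (simp add: grad_F_def)
  moreover have "open {y. cut_arg y < 0}"
    using continuous_cut_arg by (intro open_Collect_less) auto
  ultimately show ?thesis
    by (rule has_derivative_transform_within_open)
      (use False cut_arg_neg[of x] in \<open>auto simp: F_def step_eq_0\<close>)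
qed

lemma continuous_V_ball: "continuous_on (ball 0 R) V"
  by (intro continuous_at_imp_continuous_on ballI has_derivative_continuous[OF der]) auto

lemma continuous_grad_F: "continuous_on UNIV grad_F"
proof -
  let ?T = "{y. cut_arg y < 0}"
  have "continuous_on (ball 0 R \<union> ?T) grad_F"
  proof (rule continuous_on_open_Un)
    show "open ?T" using continuous_cut_arg by (intro open_Collect_less) auto
    have "continuous_on (ball 0 R) (\<lambda>x. exp ((norm x)\<^sup>2 / 2 - V x) *\<^sub>R
     (step (cut_arg x) *\<^sub>R (x - v x) - (step' (cut_arg x) * (36 / 5) / R\<^sup>2) *\<^sub>R x))"
      using R_ge DERIV_continuous_on[OF DERIV_step[THEN has_field_derivative_at_within]]
      by (intro continuous_intros continuous_V_ball cont_v continuous_cut_arg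
        continuous_on_compose2[OF continuous_step' continuous_cut_arg]
        continuous_on_compose2[OF _ continuous_cut_arg, of UNIV step]) auto
    then show "continuous_on (ball 0 R) grad_F"
      by (rule continuous_on_eq) (auto simp: grad_F_def)
    have "continuous_on ?T (\<lambda>x. 0 :: 'a)" by simp
    then show "continuous_on ?T grad_F"
      by (rule continuous_on_eq) (auto simp: grad_F_def step_eq_0 step'_def)
  qed simp
  moreover have "ball 0 R \<union> ?T = UNIV" using cut_arg_neg by (force simp: not_less)
  ultimately show ?thesis by simp
qed

lemma borel_F [measurable]: "F \<in> borel_measurable borel"
  by (intro borel_measurable_continuous_onI continuous_at_imp_continuous_on ballI
      has_derivative_continuous[OF has_derivative_F])

section \<open>The cut-off and full densities and their mass far from the origin\<close>

definition q :: "'a \<Rightarrow> real" where "q x = F x * exp (- (norm x)\<^sup>2 / 2)"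

definition p :: "'a \<Rightarrow> real" where "p x = indicator \<Omega> x * exp (- V x)"

lemma q_eq: "q x = (if norm x < R then step (cut_arg x) * exp (- V x) else 0)"
  by (auto simp: q_def F_def mult.assoc exp_add[symmetric])

lemma q_nonneg: "0 \<le> q x" and p_nonneg: "0 \<le> p x"
  by (auto simp: q_eq step_nonneg p_def)

lemma borel_q [measurable]: "q \<in> borel_measurable borel"
  unfolding q_def by measurable

lemma borel_p [measurable]: "p \<in> borel_measurable borel"
proof -
  have "(\<lambda>x. indicator \<Omega> x *\<^sub>R exp (- V x)) \<in> borel_measurable borel"
    using open_\<Omega> convex_on_continuous[OF open_\<Omega> convex_V]
    by (intro borel_measurable_continuous_on_indicator continuous_intros) auto
  then show ?thesis by (simp add: p_def[abs_def])
qed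

lemma q_le_p: "q x \<le> p x"
proof (cases "norm x < R")
  case True
  then have "x \<in> \<Omega>" using ball_\<Omega> by auto
  then show ?thesis using True by (simp add: q_eq p_def step_le_1)
qed (simp add: q_eq p_def)

text \<open>A common envelope for all contributions from outside the ball of radius
  \<open>R0\<close>: the tail of \<open>p\<close>, Gaussian tails, and the slope of the cutoff. The
  exponent is linear in the norm because convexity gives no more for \<open>p\<close>.\<close>

definition w :: "'a \<Rightarrow> real" where "w x = indicator {x. R0 \<le> norm x} x * exp (- (3 / 8 * R0 * norm x))"

lemma w_nonneg: "0 \<le> w x" by (simp add: w_def)

lemma borel_w [measurable]: "w \<in> borel_measurable borel"
  unfolding w_def by measurable

lemma p_le_q_plus_w: "p x \<le> q x + w x"
proof (cases "norm x < R0")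
  case True
  then have "x \<in> \<Omega>" "norm x < R" using ball_\<Omega> R0 by auto
  with True show ?thesis using cut_arg_ge_1[of x] by (simp add: p_def q_eq w_def step_eq_1)
next
  case False
  have "p x \<le> w x"
    using V_outer[of x] False by (cases "x \<in> \<Omega>") (auto simp: p_def w_def)
  then show ?thesis using q_nonneg[of x] by simp
qed

lemma outer_bound: "R0 \<le> norm x \<Longrightarrow> c \<ge> 3 / 8 \<Longrightarrow> exp (- (c * (norm x)\<^sup>2)) \<le> w x"
proof -
  assume x: "R0 \<le> norm x" and c: "c \<ge> 3 / 8"
  have "3 / 8 * (R0 * norm x) \<le> c * (norm x * norm x)"
    using x c R0 by (intro mult_mono mult_right_mono) auto
  then show ?thesis using x by (simp add: w_def power2_eq_square)
qed

lemma gauss_le_q_plus_w: "exp (- (5 / 8 * (norm x)\<^sup>2)) \<le> q x + w x"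
proof (cases "norm x < R0")
  case True
  with V_bounds(2)[of x] R0 have "V x \<le> 5 / 8 * (norm x)\<^sup>2" "norm x < R" by auto
  then show ?thesis using True cut_arg_ge_1[of x] by (simp add: q_eq w_def step_eq_1)
next
  case False
  then show ?thesis using q_nonneg[of x] outer_bound[of x "5/8"] by simp
qed

definition "\<tau> = exp (- real (DIM('a)) * r\<^sup>2 / 9) / 2"

lemma \<tau>: "0 < \<tau>" "\<tau> \<le> 1 / 2" by (auto simp: \<tau>_def)

lemma R0_eq: "R0 = 5 / 6 * (r * sqrt (DIM('a)))"
  using R0_def R_eq by metis

text \<open>Of the rate 3/8 R0, the part 1/4 R0 is frozen at norm \<open>R0\<close> and gives the
  small prefactor, while 1/8 R0 keeps the integral finite. As \<open>R0\<close> is proportional to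
  sqrt d, everything is a d-th power, and it remains to check one scalar inequality in
  \<open>r\<close>.\<close>

lemma w_integral: "(\<integral>\<^sup>+x. ennreal (w x) \<partial>lborel) \<le> ennreal \<tau>"
proof -
  let ?D = "DIM('a)"
  have "(\<integral>\<^sup>+x. ennreal (w x) \<partial>lborel)
     \<le> (\<integral>\<^sup>+x. ennreal (exp (- (R0\<^sup>2 / 4))) * ennreal (exp (- (R0 / 8 * norm x))) \<partial>(lborel::'a measure))"
  proof (intro nn_integral_mono)
    fix x :: 'a
    have "w x \<le> exp (- (R0\<^sup>2 / 4)) * exp (- (R0 / 8 * norm x))"
    proof (cases "R0 \<le> norm x")
      case True
      then have "R0 * R0 \<le> R0 * norm x" using R0 by (intro mult_left_mono) auto
      then show ?thesis using True by (simp add: w_def exp_add[symmetric] power2_eq_square)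
    qed (simp add: w_def)
    then show "ennreal (w x) \<le> ennreal (exp (- (R0\<^sup>2 / 4))) * ennreal (exp (- (R0 / 8 * norm x)))"
      by (simp add: ennreal_mult'[symmetric] ennreal_leI)
  qed
  also have "\<dots> \<le> ennreal (exp (- (R0\<^sup>2 / 4))) * ennreal ((2 * sqrt ?D / (R0 / 8)) ^ ?D)"
    using R0 nn_integral_lborel_exp_norm[of "R0 / 8", where 'a = 'a]
    by (subst nn_integral_cmult) (auto intro!: mult_left_mono)
  also have "\<dots> = ennreal (exp (- (R0\<^sup>2 / 4)) * (2 * sqrt ?D / (R0 / 8)) ^ ?D)"
    by (simp add: ennreal_mult')
  also have "\<dots> \<le> ennreal \<tau>"
  proof (rule ennreal_leI)
    have "R0\<^sup>2 / 4 = real ?D * (25 / 144 * r\<^sup>2)"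
      by (simp add: R0_eq power_mult_distrib power_divide)
    then have "exp (- (R0\<^sup>2 / 4)) = exp (- (25 / 144 * r\<^sup>2)) ^ ?D"
      by (simp add: exp_of_nat_mult[symmetric])
    moreover have "2 * sqrt ?D / (R0 / 8) = 96 / (5 * r)"
      using r_ge by (simp add: R0_eq field_simps)
    ultimately have "exp (- (R0\<^sup>2 / 4)) * (2 * sqrt ?D / (R0 / 8)) ^ ?D
        = (exp (- (25 / 144 * r\<^sup>2)) * (96 / (5 * r))) ^ ?D"
      by (simp only: power_mult_distrib)
    also have "\<dots> \<le> (exp (- (r\<^sup>2 / 9)) / 2) ^ ?D"
    proof (rule power_mono)
      \<comment> \<open>25/144 = 1/9 + 1/16, and r^2/16 \<ge> 9/4. With exp (- 9/4) \<le> 5/32 and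
        96 / (5 r) \<le> 16/5 the spare factor is at most 1/2.\<close>
      have "(36::real) \<le> r\<^sup>2" using r_ge power_mono[of 6 r 2] by simp
      moreover have "exp (- (25 / 144 * r\<^sup>2)) = exp (- (r\<^sup>2 / 9)) * exp (- (r\<^sup>2 / 16))"
        by (simp add: exp_add[symmetric])
      ultimately have "exp (- (25 / 144 * r\<^sup>2)) \<le> exp (- (r\<^sup>2 / 9)) * exp (- (9 / 4))"
        by simp
      also have "\<dots> \<le> exp (- (r\<^sup>2 / 9)) * (5 / 32)"
      proof -
        have "(32 / 5 :: real) \<le> (1 + 9 / 8 + (9 / 8)\<^sup>2 / 2)\<^sup>2" by (simp add: power2_eq_square)
        also have "\<dots> \<le> (exp (9 / 8))\<^sup>2"
          by (intro power_mono exp_lower_Taylor_quadratic) auto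
        also have "\<dots> = exp (9 / 4)" by (simp add: exp_double[symmetric])
        finally show ?thesis by (simp add: exp_minus field_simps)
      qed
      finally have "exp (- (25 / 144 * r\<^sup>2)) * (96 / (5 * r)) \<le> exp (- (r\<^sup>2 / 9)) * (5 / 32) * (16 / 5)"
        using r_ge by (intro mult_mono) (auto simp: field_simps)
      then show "exp (- (25 / 144 * r\<^sup>2)) * (96 / (5 * r)) \<le> exp (- (r\<^sup>2 / 9)) / 2" by simp
    qed (use r_ge in simp)
    also have "\<dots> = exp (- (r\<^sup>2 / 9)) ^ ?D / 2 ^ ?D" by (simp add: power_divide)
    \<comment> \<open>Only one of the d factors 1/2 is kept, so that \<open>\<tau>\<close> has the
      same form in every dimension.\<close>
    also have "\<dots> \<le> exp (- (r\<^sup>2 / 9)) ^ ?D / 2 ^ 1"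
      by (intro divide_left_mono power_increasing) (auto simp: Suc_leI)
    also have "\<dots> = \<tau>" by (simp add: \<tau>_def exp_of_nat_mult[symmetric])
    finally show "exp (- (R0\<^sup>2 / 4)) * (2 * sqrt ?D / (R0 / 8)) ^ ?D \<le> \<tau>" .
  qed
  finally show ?thesis .
qed

lemma integrable_w: "integrable lborel w" and integral_w: "integral\<^sup>L lborel w \<le> \<tau>"
proof -
  show i: "integrable lborel w"
    using w_integral w_nonneg by (auto intro!: integrableI_nonneg simp: less_top[symmetric] top_unique)
  show "integral\<^sup>L lborel w \<le> \<tau>"
    using w_integral \<tau> w_nonneg by (simp add: nn_integral_eq_integral[OF i] ennreal_le_iff)
qed

lemma q_le_gauss: "q x \<le> exp (- (3 / 8 * (norm x)\<^sup>2))"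
proof (cases "norm x < R")
  case True
  have "step (cut_arg x) * exp (- V x) \<le> 1 * exp (- (3 / 8 * (norm x)\<^sup>2))"
    using V_bounds(1)[OF True] by (intro mult_mono step_le_1) (auto simp: step_nonneg)
  with True show ?thesis by (simp add: q_eq)
qed (simp add: q_eq)

lemma integrable_q: "integrable lborel q"
  by (rule Bochner_Integration.integrable_bound[of _ "\<lambda>x. exp (- (3 / 8 * (norm x)\<^sup>2))"])
     (use has_bochner_integral_gaussian[of "3/8", where 'a = 'a] q_le_gauss q_nonneg in
      \<open>auto simp: has_bochner_integral_iff intro!: always_eventually\<close>)

lemma integrable_p: "integrable lborel p"
  by (rule Bochner_Integration.integrable_bound[of _ "\<lambda>x. q x + w x"])
     (use p_le_q_plus_w p_nonneg q_nonneg w_nonneg in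
      \<open>auto intro!: always_eventually integrable_q integrable_w simp: abs_of_nonneg add_nonneg_nonneg\<close>)

definition "Zq = integral\<^sup>L lborel q"
definition "Zp = integral\<^sup>L lborel p"

text \<open>The Gaussian exp (- 5/8 |x|^2) is below q + w and has mass at least 3/2, of which
  \<open>w\<close> takes at most 1/2. A lower bound 1 lets absolute errors of size
  \<open>\<tau>\<close> pass to the normalised densities without growing.\<close>

lemma Zq_ge_1: "1 \<le> Zq"
proof -
  have "(3 / 2 :: real) \<le> sqrt (pi / (5 / 8))"
    using pi_approx(1) by (intro real_le_rsqrt) (simp add: power2_eq_square)
  then have "(3 / 2 :: real) \<le> sqrt (pi / (5 / 8)) ^ 1" by (simp only: power_one_right)
  also have "\<dots> \<le> sqrt (pi / (5 / 8)) ^ DIM('a)"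
    using pi_approx(1) by (intro power_increasing) (auto simp: Suc_leI)
  also have "\<dots> = (\<integral>x. exp (- (5 / 8 * (norm x)\<^sup>2)) \<partial>(lborel :: 'a measure))"
    using has_bochner_integral_gaussian[of "5/8", where 'a = 'a] by (simp add: has_bochner_integral_iff)
  also have "\<dots> \<le> (\<integral>x. q x + w x \<partial>lborel)"
    using has_bochner_integral_gaussian[of "5/8", where 'a = 'a] gauss_le_q_plus_w integrable_q integrable_w
    by (intro integral_mono) (auto simp: has_bochner_integral_iff)
  also have "\<dots> = Zq + integral\<^sup>L lborel w"
    using integrable_q integrable_w by (simp add: Zq_def)
  finally show ?thesis using integral_w \<tau> by simp
qed

lemma Zp_bounds: "Zq \<le> Zp" "Zp \<le> Zq + \<tau>"
proof -
  show "Zq \<le> Zp" unfolding Zq_def Zp_def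
    by (intro integral_mono integrable_q integrable_p q_le_p)
  have "Zp \<le> (\<integral>x. q x + w x \<partial>lborel)" unfolding Zp_def
    using integrable_q integrable_w by (intro integral_mono integrable_p p_le_q_plus_w) auto
  then show "Zp \<le> Zq + \<tau>" using integrable_q integrable_w integral_w by (simp add: Zq_def)
qed

section \<open>The second moment by dilation\<close>

lemma has_integral_q_scaled:
  assumes s: "s > 0"
  shows "has_bochner_integral lborel (\<lambda>x. q (s *\<^sub>R x)) (Zq / s ^ DIM('a))"
proof (rule has_bochner_integral_nn_integral)
  have "ennreal Zq = ennreal (s ^ DIM('a)) * (\<integral>\<^sup>+x. ennreal (q (s *\<^sub>R x)) \<partial>lborel)"
    using nn_integral_lborel_affine[of "\<lambda>x. ennreal (q x)" s 0] s
      nn_integral_eq_integral[OF integrable_q] q_nonneg by (simp add: Zq_def)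
  then have "ennreal (1 / s ^ DIM('a)) * ennreal Zq
     = ennreal (1 / s ^ DIM('a)) * ennreal (s ^ DIM('a)) * (\<integral>\<^sup>+x. ennreal (q (s *\<^sub>R x)) \<partial>lborel)"
    by (simp add: mult.assoc)
  also have "ennreal (1 / s ^ DIM('a)) * ennreal (s ^ DIM('a)) = 1"
    using s by (simp flip: ennreal_mult'')
  finally show "(\<integral>\<^sup>+x. ennreal (q (s *\<^sub>R x)) \<partial>lborel) = ennreal (Zq / s ^ DIM('a))"
    using s Zq_ge_1 by (simp flip: ennreal_mult'')
qed (use Zq_ge_1 s in \<open>auto simp: q_nonneg\<close>)

text \<open>The cutoff decreases along rays, so dilation only helps there. Replacing exp (- y) by
  its quadratic majorant leaves just \<open>q\<close> and \<open>q\<close> times |x|^2 to integrate,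
  with a remainder of second order in s - 1, uniform because |x| < R.\<close>

lemma q_scaled_le:
  assumes s: "1 \<le> s"
  shows "q (s *\<^sub>R x) \<le> q x * (1 - 3 / 8 * (s\<^sup>2 - 1) * (norm x)\<^sup>2 + 9 / 128 * (s\<^sup>2 - 1)\<^sup>2 * R ^ 4)"
proof (cases "norm (s *\<^sub>R x) < R")
  case True
  define y where "y = 3 / 8 * (s\<^sup>2 - 1) * (norm x)\<^sup>2"
  have y: "0 \<le> y" using s by (simp add: y_def)
  have nx: "norm x \<le> norm (s *\<^sub>R x)" using s mult_right_mono[of 1 s "norm x"] by simp
  have "V x + y \<le> V (s *\<^sub>R x)" using radial_growth(1)[of 1 s x] s True by (simp add: y_def)
  then have "q (s *\<^sub>R x) \<le> step (cut_arg x) * (exp (- V x) * exp (- y))"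
    using True cut_arg_antimono[OF nx]
    by (simp add: q_eq exp_add[symmetric]) (intro mult_mono step_mono, auto simp: step_nonneg)
  also have "\<dots> = q x * exp (- y)" using True nx by (simp add: q_eq)
  also have "\<dots> \<le> q x * (1 - y + y\<^sup>2 / 2)"
    by (intro mult_left_mono exp_minus_le_quadratic y q_nonneg)
  also have "\<dots> \<le> q x * (1 - y + 9 / 128 * (s\<^sup>2 - 1)\<^sup>2 * R ^ 4)"
  proof (intro mult_left_mono q_nonneg)
    have "(norm x) ^ 4 \<le> R ^ 4" using True nx by (intro power_mono) auto
    then have "9 / 128 * (s\<^sup>2 - 1)\<^sup>2 * (norm x) ^ 4 \<le> 9 / 128 * (s\<^sup>2 - 1)\<^sup>2 * R ^ 4"
      by (intro mult_left_mono) auto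
    moreover have "y\<^sup>2 / 2 = 9 / 128 * (s\<^sup>2 - 1)\<^sup>2 * (norm x) ^ 4"
      by (simp only: y_def power_mult_distrib power_divide) (simp flip: power_mult)
    ultimately show "1 - y + y\<^sup>2 / 2 \<le> 1 - y + 9 / 128 * (s\<^sup>2 - 1)\<^sup>2 * R ^ 4" by linarith
  qed
  finally show ?thesis by (simp add: y_def)
next
  \<comment> \<open>The dilated point has left the ball, so the left side is 0 and the bracket only
    has to be nonnegative; this follows from 2 k R^2 \<le> 1 + (k R^2)^2.\<close>
  case False
  show ?thesis
  proof (cases "norm x < R")
    case True
    define k where "k = 3 / 8 * (s\<^sup>2 - 1)"
    have k: "0 \<le> k" using s by (simp add: k_def)
    have "k * (norm x)\<^sup>2 \<le> k * R\<^sup>2" using True k by (intro mult_left_mono power_mono) auto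
    moreover have "k * R\<^sup>2 \<le> 1 + 9 / 128 * (s\<^sup>2 - 1)\<^sup>2 * R ^ 4"
    proof -
      have k2: "(k * R\<^sup>2)\<^sup>2 = 9 / 64 * (s\<^sup>2 - 1)\<^sup>2 * R ^ 4"
        by (simp only: k_def power_mult_distrib power_divide) (simp flip: power_mult)
      have "0 \<le> (k * R\<^sup>2 - 1)\<^sup>2" by simp
      also have "\<dots> = 2 * (9 / 128 * (s\<^sup>2 - 1)\<^sup>2 * R ^ 4) + 1 - 2 * (k * R\<^sup>2)"
        unfolding power2_diff k2 by simp
      finally show ?thesis by linarith
    qed
    ultimately have "0 \<le> 1 - k * (norm x)\<^sup>2 + 9 / 128 * (s\<^sup>2 - 1)\<^sup>2 * R ^ 4" by linarith
    then show ?thesis using False q_nonneg[of x] by (simp add: q_eq[of "s *\<^sub>R x"] k_def)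
  qed (use False in \<open>simp add: q_eq\<close>)
qed

lemma integrable_q_sq: "integrable lborel (\<lambda>x. q x * (norm x)\<^sup>2)"
proof (rule Bochner_Integration.integrable_bound[of _ "\<lambda>x. R\<^sup>2 * q x"])
  show "AE x in lborel. norm (q x * (norm x)\<^sup>2) \<le> norm (R\<^sup>2 * q x)"
  proof (intro always_eventually allI)
    fix x
    show "norm (q x * (norm x)\<^sup>2) \<le> norm (R\<^sup>2 * q x)"
    proof (cases "norm x < R")
      case True
      then have "(norm x)\<^sup>2 \<le> R\<^sup>2" by (intro power_mono) auto
      then show ?thesis using q_nonneg[of x] by (simp add: abs_mult mult.commute mult_left_mono)
    qed (simp add: q_eq)
  qed
qed (use integrable_q in auto)

text \<open>Compares \<open>q\<close> with its dilation by \<open>s\<close>, to first order as \<open>s\<close> tends to \<open>1\<close> from above.\<close>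
lemma second_moment_q: "(\<integral>x. q x * (norm x)\<^sup>2 \<partial>lborel) \<le> 4 / 3 * DIM('a) * Zq"
proof -
  define M where "M = (\<integral>x. q x * (norm x)\<^sup>2 \<partial>lborel)"
  have *: "3 / 8 * (2 + h) * M \<le> Zq * (DIM('a) + 9 / 128 * R ^ 4 * h * (2 + h)\<^sup>2)" if h: "0 < h" for h
  proof -
    define s where "s = 1 + h"
    have s: "1 \<le> s" "0 < s" "s\<^sup>2 - 1 = h * (2 + h)" using h by (auto simp: s_def power2_eq_square algebra_simps)
    have "Zq / s ^ DIM('a) = (\<integral>x. q (s *\<^sub>R x) \<partial>lborel)"
      using has_integral_q_scaled[OF s(2)] by (simp add: has_bochner_integral_iff)
    also have "\<dots> \<le> (\<integral>x. q x * (1 + 9 / 128 * (s\<^sup>2 - 1)\<^sup>2 * R ^ 4) - 3 / 8 * (s\<^sup>2 - 1) * (q x * (norm x)\<^sup>2) \<partial>lborel)"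
    proof (rule integral_mono)
      show "integrable lborel (\<lambda>x. q (s *\<^sub>R x))"
        using has_integral_q_scaled[OF s(2)] by (simp add: has_bochner_integral_iff)
      show "integrable lborel (\<lambda>x. q x * (1 + 9 / 128 * (s\<^sup>2 - 1)\<^sup>2 * R ^ 4) - 3 / 8 * (s\<^sup>2 - 1) * (q x * (norm x)\<^sup>2))"
        using integrable_q integrable_q_sq by simp
      show "q (s *\<^sub>R x) \<le> q x * (1 + 9 / 128 * (s\<^sup>2 - 1)\<^sup>2 * R ^ 4) - 3 / 8 * (s\<^sup>2 - 1) * (q x * (norm x)\<^sup>2)" for x
        using q_scaled_le[OF s(1), of x] by (simp add: algebra_simps)
    qed
    also have "\<dots> = Zq * (1 + 9 / 128 * (s\<^sup>2 - 1)\<^sup>2 * R ^ 4) - 3 / 8 * (s\<^sup>2 - 1) * M"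
      using integrable_q integrable_q_sq by (simp add: Zq_def M_def)
    finally have "3 / 8 * (s\<^sup>2 - 1) * M \<le> Zq * (1 + 9 / 128 * (s\<^sup>2 - 1)\<^sup>2 * R ^ 4) - Zq * (1 / s) ^ DIM('a)"
      by (simp add: power_divide)
    also have "\<dots> = Zq * (1 + 9 / 128 * (s\<^sup>2 - 1)\<^sup>2 * R ^ 4 - (1 / s) ^ DIM('a))"
      by (simp add: algebra_simps)
    also have "\<dots> \<le> Zq * (h * (DIM('a) + 9 / 128 * R ^ 4 * h * (2 + h)\<^sup>2))"
    proof (rule mult_left_mono)
      \<comment> \<open>Bernoulli's inequality replaces differentiation of s^(-d) at s = 1, using
        1/s - 1 \<ge> - h.\<close>
      have "1 - DIM('a) * h \<le> 1 + DIM('a) * (1 / s - 1)"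
        using h by (simp add: s_def field_simps)
      also have "\<dots> \<le> (1 + (1 / s - 1)) ^ DIM('a)"
        using s by (intro Bernoulli_inequality) simp
      finally have "1 - DIM('a) * h \<le> (1 / s) ^ DIM('a)" by simp
      moreover have "9 / 128 * (s\<^sup>2 - 1)\<^sup>2 * R ^ 4 = h * (9 / 128 * R ^ 4 * h * (2 + h)\<^sup>2)"
        unfolding s(3) by (simp add: power2_eq_square)
      ultimately show "1 + 9 / 128 * (s\<^sup>2 - 1)\<^sup>2 * R ^ 4 - (1 / s) ^ DIM('a)
          \<le> h * (DIM('a) + 9 / 128 * R ^ 4 * h * (2 + h)\<^sup>2)"
        unfolding distrib_left mult.commute[of h "real DIM('a)"] by linarith
    qed (use Zq_ge_1 in simp)
    finally have "h * (3 / 8 * (2 + h) * M) \<le> h * (Zq * (DIM('a) + 9 / 128 * R ^ 4 * h * (2 + h)\<^sup>2))"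
      by (simp add: s(3) mult_ac)
    with h show ?thesis by (simp only: mult_le_cancel_left_pos)
  qed
  \<comment> \<open>With h already divided out, the remainder vanishes in the limit; what is left
    has coefficient 3/8 * 2 = 3/4, the source of 4/3.\<close>
  have "3 / 8 * (2 + 0) * M \<le> Zq * (DIM('a) + 9 / 128 * R ^ 4 * 0 * (2 + 0)\<^sup>2)"
  proof (rule tendsto_le[of "at_right (0::real)"])
    show "((\<lambda>h. Zq * (DIM('a) + 9 / 128 * R ^ 4 * h * (2 + h)\<^sup>2))
        \<longlongrightarrow> Zq * (DIM('a) + 9 / 128 * R ^ 4 * 0 * (2 + 0)\<^sup>2)) (at_right 0)"
      by (intro tendsto_intros)
    show "((\<lambda>h. 3 / 8 * (2 + h) * M) \<longlongrightarrow> 3 / 8 * (2 + 0) * M) (at_right 0)"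
      by (intro tendsto_intros)
    show "\<forall>\<^sub>F h in at_right 0. 3 / 8 * (2 + h) * M \<le> Zq * (DIM('a) + 9 / 128 * R ^ 4 * h * (2 + h)\<^sup>2)"
      using * by (auto simp: eventually_at_filter)
  qed simp
  then have "3 / 4 * M \<le> Zq * DIM('a)" by simp
  then have "M \<le> 4 / 3 * (DIM('a) * Zq)" by (simp add: mult.commute)
  then show ?thesis by (simp add: M_def mult.assoc)
qed

text \<open>The Gaussian weight cancels the factor exp (|x|^2 / 2), so the first part of
  \<open>grad_F\<close> becomes \<open>q\<close> times the gradient error. The second part contains
  the slope of the cutoff, which vanishes up to norm \<open>R0\<close>, so that \<open>w\<close> can
  absorb it.\<close>

lemma grad_F_bound:
  "norm (grad_F x) * exp (- (norm x)\<^sup>2 / 2) \<le> L / 2 * (q x * (norm x)\<^sup>2) + 12 / 5 * w x"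
proof (cases "norm x < R")
  case True
  let ?st = "step (cut_arg x)" and ?sp = "step' (cut_arg x) * (36 / 5) / R\<^sup>2"
  have E: "exp ((norm x)\<^sup>2 / 2 - V x) * exp (- (norm x)\<^sup>2 / 2) = exp (- V x)"
    by (simp add: exp_add[symmetric])
  have "norm (grad_F x) * exp (- (norm x)\<^sup>2 / 2)
      = (exp ((norm x)\<^sup>2 / 2 - V x) * exp (- (norm x)\<^sup>2 / 2)) * norm (?st *\<^sub>R (x - v x) - ?sp *\<^sub>R x)"
    using True by (simp add: grad_F_def)
  also have "\<dots> = exp (- V x) * norm (?st *\<^sub>R (x - v x) - ?sp *\<^sub>R x)" by (simp only: E)
  also have "\<dots> \<le> exp (- V x) * (?st * (L / 2 * (norm x)\<^sup>2) + ?sp * norm x)"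
  proof (rule mult_left_mono)
    have "norm (?st *\<^sub>R (x - v x) - ?sp *\<^sub>R x) \<le> norm (?st *\<^sub>R (x - v x)) + norm (?sp *\<^sub>R x)"
      by (rule norm_triangle_ineq4)
    also have "\<dots> = ?st * norm (v x - x) + ?sp * norm x"
      by (simp add: step_nonneg step'_bounds abs_mult norm_minus_commute)
    also have "\<dots> \<le> ?st * (L / 2 * (norm x)\<^sup>2) + ?sp * norm x"
      by (intro add_right_mono mult_left_mono near True step_nonneg)
    finally show "norm (?st *\<^sub>R (x - v x) - ?sp *\<^sub>R x) \<le> ?st * (L / 2 * (norm x)\<^sup>2) + ?sp * norm x" .
  qed simp
  also have "\<dots> = L / 2 * (q x * (norm x)\<^sup>2) + exp (- V x) * (?sp * norm x)"
    using True by (simp add: q_eq algebra_simps)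
  also have "exp (- V x) * (?sp * norm x) \<le> 12 / 5 * w x"
  proof (cases "norm x < R0")
    case True
    then show ?thesis using step'_eq_0[OF cut_arg_ge_1[of x]] w_nonneg[of x] by simp
  next
    case False
    \<comment> \<open>The slope of \<open>step\<close> is at most 2, the gradient of
      \<open>cut_arg\<close> has norm 36/5 |x| / R^2, and R \<ge> 6 turns the result into
      12/5.\<close>
    have "?sp * norm x \<le> 2 * (36 / 5) / R\<^sup>2 * R"
      using True step'_bounds by (intro mult_mono divide_right_mono) auto
    also have "\<dots> = 72 / 5 / R" using R_ge by (simp add: power2_eq_square)
    also have "\<dots> \<le> 72 / 5 / 6" using R_ge by (intro divide_left_mono) auto
    finally have "exp (- V x) * (?sp * norm x) \<le> exp (- (3 / 8 * (norm x)\<^sup>2)) * (12 / 5)"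
      using V_bounds(1)[OF True] by (intro mult_mono) (auto simp: step'_bounds)
    also have "\<dots> \<le> w x * (12 / 5)" using False by (intro mult_right_mono outer_bound) auto
    finally show ?thesis by (simp add: mult.commute)
  qed
  finally show ?thesis by simp
next
  case False
  then show ?thesis using w_nonneg[of x] by (simp add: grad_F_def q_eq)
qed

lemma nn_integral_grad_F:
  "(\<integral>\<^sup>+x. ennreal (norm (grad_F x)) \<partial>std_gauss)
    \<le> ennreal (1 / sqrt (2 * pi) ^ DIM('a) * (2 / 3 * L * DIM('a) * Zq + 12 / 5 * \<tau>))"
proof -
  have [measurable]: "grad_F \<in> borel_measurable borel"
    by (intro borel_measurable_continuous_onI continuous_grad_F)
  let ?g = "\<lambda>x. L / 2 * (q x * (norm x)\<^sup>2) + 12 / 5 * w x"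
  have i: "integrable lborel ?g" using integrable_q_sq integrable_w by auto
  have "(\<integral>\<^sup>+x. ennreal (norm (grad_F x)) \<partial>std_gauss)
     \<le> ennreal (1 / sqrt (2 * pi) ^ DIM('a)) * (\<integral>\<^sup>+x. ennreal (?g x) \<partial>lborel)"
    using grad_F_bound
    by (subst nn_integral_std_gauss)
       (auto intro!: mult_left_mono nn_integral_mono ennreal_leI simp: ennreal_mult''[symmetric] mult.commute)
  also have "(\<integral>\<^sup>+x. ennreal (?g x) \<partial>lborel) = ennreal (integral\<^sup>L lborel ?g)"
    using L_nonneg q_nonneg w_nonneg by (intro nn_integral_eq_integral i always_eventually allI) simp
  also have "integral\<^sup>L lborel ?g = L / 2 * (\<integral>x. q x * (norm x)\<^sup>2 \<partial>lborel) + 12 / 5 * integral\<^sup>L lborel w"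
    using integrable_q_sq integrable_w by simp
  also have "\<dots> \<le> L / 2 * (4 / 3 * DIM('a) * Zq) + 12 / 5 * \<tau>"
    using L_nonneg second_moment_q integral_w by (intro add_mono mult_left_mono) auto
  also have "\<dots> = 2 / 3 * L * DIM('a) * Zq + 12 / 5 * \<tau>" by simp
  finally have "(\<integral>\<^sup>+x. ennreal (norm (grad_F x)) \<partial>std_gauss)
     \<le> ennreal (1 / sqrt (2 * pi) ^ DIM('a)) * ennreal (2 / 3 * L * DIM('a) * Zq + 12 / 5 * \<tau>)"
    by (simp add: mult_left_mono ennreal_leI)
  then show ?thesis by (subst ennreal_mult') auto
qed

lemma integrable_F_std_gauss: "integrable std_gauss F"
proof -
  have "integrable lborel (\<lambda>x. exp (- (norm x)\<^sup>2 / 2) / sqrt (2 * pi) ^ DIM('a) * F x)"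
    using integrable_divide[OF integrable_q, of "sqrt (2 * pi) ^ DIM('a)"]
    by (simp add: q_def mult.commute)
  then show ?thesis unfolding std_gauss_def
    by (subst integrable_density) auto
qed

text \<open>Up to the factor \<open>?C\<close> times \<open>Zq\<close>, the difference is the
  covariance of \<open>F\<close> with the indicator of \<open>B\<close> under the Gaussian. The
  Poincare bound is homogeneous in \<open>F\<close>, so normalisation can wait until the
  end.\<close>

lemma tv_cut:
  assumes B: "B \<in> sets borel"
  shows "\<bar>(\<integral>x. indicator B x * q x \<partial>lborel) / Zq - measure std_gauss B\<bar>
    \<le> L * DIM('a) / sqrt 2 + 5 / 2 * \<tau>"
proof -
  let ?C = "1 / sqrt (2 * pi) ^ DIM('a)"
  let ?k = "pi / 2 * gauss_abs_bound"
  have C: "0 < ?C" by simp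
  have B' [measurable]: "B \<in> sets std_gauss" using B by simp
  have EF: "std_gauss.expectation F = ?C * Zq"
    by (subst integral_std_gauss) (simp_all add: Zq_def q_def[abs_def])
  have EFB: "(\<integral>x. F x * indicator B x \<partial>std_gauss) = ?C * (\<integral>x. indicator B x * q x \<partial>lborel)"
    using B by (subst integral_std_gauss) (simp_all add: q_def mult_ac)
  define A where "A = (\<integral>x. indicator B x * q x \<partial>lborel)"
  have "ennreal (2 * \<bar>?C * A - ?C * Zq * measure std_gauss B\<bar>)
     \<le> ennreal ?k * (\<integral>\<^sup>+x. ennreal (norm (grad_F x)) \<partial>std_gauss)"
    using std_gauss.abs_covariance_indicator_le[OF integrable_F_std_gauss B']
      std_gauss_L1_poincare[OF has_derivative_F continuous_grad_F]
    unfolding EF EFB A_def by (rule order_trans)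
  also have "\<dots> \<le> ennreal ?k * ennreal (?C * (2 / 3 * L * DIM('a) * Zq + 12 / 5 * \<tau>))"
    by (intro mult_left_mono nn_integral_grad_F) auto
  also have "\<dots> = ennreal (?k * (?C * (2 / 3 * L * DIM('a) * Zq + 12 / 5 * \<tau>)))"
    using gauss_abs_bound_nonneg by (subst ennreal_mult') simp_all
  finally have "2 * \<bar>?C * A - ?C * Zq * measure std_gauss B\<bar>
     \<le> ?k * (?C * (2 / 3 * L * DIM('a) * Zq + 12 / 5 * \<tau>))"
    using gauss_abs_bound_nonneg L_nonneg Zq_ge_1 \<tau> by (subst (asm) ennreal_le_iff) auto
  also have "?C * A - ?C * Zq * measure std_gauss B = ?C * Zq * (A / Zq - measure std_gauss B)"
    using Zq_ge_1 by (simp add: field_simps)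
  also have "\<bar>?C * Zq * (A / Zq - measure std_gauss B)\<bar> = ?C * Zq * \<bar>A / Zq - measure std_gauss B\<bar>"
    using Zq_ge_1 by (simp add: abs_mult)
  also have "?k * (?C * (2 / 3 * L * DIM('a) * Zq + 12 / 5 * \<tau>))
      = ?C * Zq * (?k * (2 / 3 * L * DIM('a) + 12 / 5 * \<tau> / Zq))"
    using Zq_ge_1 by (simp add: distrib_left)
  finally have "?C * Zq * (2 * \<bar>A / Zq - measure std_gauss B\<bar>)
     \<le> ?C * Zq * (?k * (2 / 3 * L * DIM('a) + 12 / 5 * \<tau> / Zq))"
    by (simp only: mult.assoc mult.left_commute)
  then have "2 * \<bar>A / Zq - measure std_gauss B\<bar> \<le> ?k * (2 / 3 * L * DIM('a) + 12 / 5 * \<tau> / Zq)"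
    using Zq_ge_1 C by (subst (asm) mult_le_cancel_left_pos) auto
  also have "\<dots> \<le> 19 / 10 * (2 / 3 * L * DIM('a) + 12 / 5 * \<tau>)"
  proof (rule mult_mono)
    have "pi * gauss_abs_bound \<le> (32 / 10) * (117 / 100)"
      using pi_approx(2) by (intro mult_mono gauss_abs_bound_le gauss_abs_bound_nonneg) auto
    then show "?k \<le> 19 / 10" by linarith
    have "\<tau> / Zq \<le> \<tau> / 1" using Zq_ge_1 \<tau> by (intro divide_left_mono) auto
    then show "2 / 3 * L * DIM('a) + 12 / 5 * \<tau> / Zq \<le> 2 / 3 * L * DIM('a) + 12 / 5 * \<tau>" by simp
  qed (use L_nonneg \<tau> Zq_ge_1 in auto)
  finally have "\<bar>A / Zq - measure std_gauss B\<bar> \<le> 19 / 30 * (L * DIM('a)) + 114 / 50 * \<tau>" by simp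
  \<comment> \<open>19/30 is about 0.633, below 1 / sqrt 2; and 114/50 = 2.28 is below 5/2.\<close>
  also have "\<dots> \<le> L * DIM('a) / sqrt 2 + 5 / 2 * \<tau>"
  proof -
    have "sqrt 2 \<le> 30 / (19 :: real)" by (intro real_le_lsqrt) (auto simp: power2_eq_square)
    then have "19 / 30 \<le> 1 / sqrt (2 :: real)" by (simp add: field_simps)
    then have "19 / 30 * (L * DIM('a)) \<le> 1 / sqrt 2 * (L * DIM('a))"
      using L_nonneg by (intro mult_right_mono) auto
    then show ?thesis using \<tau> by simp
  qed
  finally show ?thesis by (simp add: A_def)
qed

text \<open>Since q \<le> p pointwise, the integrals over any \<open>B\<close> differ by at most Zp
  - Zq. In both directions the normalised difference is then at most (Zp - Zq) / Zp, which is below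
  \<open>\<tau>\<close> as Zp \<ge> 1.\<close>

lemma tv_tail:
  assumes [measurable]: "B \<in> sets borel"
  shows "\<bar>(\<integral>x. indicator B x * p x \<partial>lborel) / Zp - (\<integral>x. indicator B x * q x \<partial>lborel) / Zq\<bar> \<le> \<tau>"
proof -
  define a where "a = (\<integral>x. indicator B x * p x \<partial>lborel)"
  define b where "b = (\<integral>x. indicator B x * q x \<partial>lborel)"
  have i: "integrable lborel (\<lambda>x. indicator B x * p x)" "integrable lborel (\<lambda>x. indicator B x * q x)"
    using integrable_real_mult_indicator[OF _ integrable_p, of B]
      integrable_real_mult_indicator[OF _ integrable_q, of B] by (simp_all add: mult.commute)
  have b: "0 \<le> b" "b \<le> Zq"
    unfolding b_def Zq_def using i integrable_q q_nonneg
    by (auto intro!: integral_nonneg_AE integral_mono split: split_indicator)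
  have ab: "b \<le> a" unfolding a_def b_def using i q_le_p
    by (intro integral_mono) (auto split: split_indicator)
  have "a - b = (\<integral>x. indicator B x * p x - indicator B x * q x \<partial>lborel)"
    using i by (simp add: a_def b_def)
  also have "\<dots> \<le> (\<integral>x. p x - q x \<partial>lborel)"
    using i integrable_p integrable_q q_le_p
    by (intro integral_mono) (auto split: split_indicator)
  also have "\<dots> = Zp - Zq" using integrable_p integrable_q by (simp add: Zp_def Zq_def)
  finally have d: "a - b \<le> Zp - Zq" .
  have Z: "1 \<le> Zq" "Zq \<le> Zp" "Zp - Zq \<le> \<tau>" using Zq_ge_1 Zp_bounds by auto
  have t: "(Zp - Zq) / Zp \<le> \<tau>"
  proof -
    have "(Zp - Zq) / Zp \<le> (Zp - Zq) / 1" using Z by (intro divide_left_mono) auto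
    then show ?thesis using Z by simp
  qed
  have "a / Zp - b / Zq \<le> a / Zp - b / Zp" using Z b by (simp add: divide_left_mono)
  also have "\<dots> \<le> (Zp - Zq) / Zp" using d Z by (simp add: diff_divide_distrib[symmetric] divide_right_mono)
  finally have 1: "a / Zp - b / Zq \<le> \<tau>" using t by simp
  have "b / Zq - a / Zp \<le> b / Zq - b / Zp" using ab Z by (simp add: divide_right_mono)
  also have "\<dots> = (b / Zq) * ((Zp - Zq) / Zp)" using Z by (simp add: field_simps)
  also have "\<dots> \<le> 1 * ((Zp - Zq) / Zp)" using Z b by (intro mult_right_mono) auto
  finally have "b / Zq - a / Zp \<le> \<tau>" using t by simp
  with 1 show ?thesis by (simp add: a_def b_def abs_le_iff)
qed

theorem tv_bound:
  assumes B: "B \<in> sets borel"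
  shows "\<bar>(\<integral>x. indicator B x * p x \<partial>lborel) / Zp - measure std_gauss B\<bar>
    \<le> L * DIM('a) / sqrt 2 + 3 * exp (- real (DIM('a)) * r\<^sup>2 / 9)"
proof -
  have "\<bar>(\<integral>x. indicator B x * p x \<partial>lborel) / Zp - measure std_gauss B\<bar>
     \<le> L * DIM('a) / sqrt 2 + 7 / 2 * \<tau>"
    using tv_cut[OF B] tv_tail[OF B] by linarith
  also have "\<dots> \<le> L * DIM('a) / sqrt 2 + 3 * exp (- real (DIM('a)) * r\<^sup>2 / 9)"
    by (simp add: \<tau>_def)
  finally show ?thesis .
qed

end

subsection \<open>Positive definite matrices\<close>

text \<open>The spectral theorem: a maximiser of the Rayleigh quotient on the unit sphere of
  \<open>S\<close> is an eigenvector, and its orthogonal complement in \<open>S\<close> is again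
  invariant. Stating it for invariant subspaces allows induction on the dimension within a fixed
  type.\<close>

lemma self_adjoint_orthonormal_eigenbasis:
  fixes f :: "'a::euclidean_space \<Rightarrow> 'a"
  assumes lin: "linear f" and sa: "\<And>x y. f x \<bullet> y = x \<bullet> f y"
    and S: "subspace S" "\<And>x. x \<in> S \<Longrightarrow> f x \<in> S"
  shows "\<exists>B. finite B \<and> B \<subseteq> S \<and> (\<forall>b\<in>B. \<forall>c\<in>B. b \<bullet> c = (if b = c then 1 else 0)) \<and>
    (\<forall>b\<in>B. \<exists>\<mu>. f b = \<mu> *\<^sub>R b) \<and> (\<forall>x\<in>S. (\<Sum>b\<in>B. (b \<bullet> x) *\<^sub>R b) = x)"
  using S
proof (induction "dim S" arbitrary: S rule: less_induct)
  case less
  interpret f: linear f by (rule lin)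
  show ?case
  proof (cases "S \<subseteq> {0}")
    case True
    then show ?thesis by (intro exI[of _ "{}"]) auto
  next
    case False
    let ?C = "sphere 0 1 \<inter> S"
    obtain s where s: "s \<in> S" "s \<noteq> 0" using False by auto
    have "s /\<^sub>R norm s \<in> ?C" using s less.prems(1) by (auto simp: subspace_scale)
    moreover have "compact ?C"
      using less.prems(1) by (intro compact_Int_closed closed_subspace) auto
    moreover have "continuous_on ?C (\<lambda>x. x \<bullet> f x)"
      using lin by (intro continuous_intros linear_continuous_on) (simp add: linear_linear)
    ultimately obtain x where x: "x \<in> ?C" and xmax: "\<And>y. y \<in> ?C \<Longrightarrow> y \<bullet> f y \<le> x \<bullet> f x"
      using continuous_attains_sup[of ?C "\<lambda>x. x \<bullet> f x"] by blast
    define M where "M = x \<bullet> f x"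
    have xS: "x \<in> S" and nx: "x \<bullet> x = 1" using x by (auto simp: norm_eq_1)
    have max: "y \<bullet> f y \<le> M * (y \<bullet> y)" if y: "y \<in> S" for y
    proof (cases "y = 0")
      case False
      have "y /\<^sub>R norm y \<in> ?C" using y False less.prems(1) by (auto simp: subspace_scale)
      from xmax[OF this] have "(y \<bullet> f y) / (norm y * norm y) \<le> M"
        by (simp add: f.scaleR M_def divide_simps)
      then show ?thesis using False by (simp add: field_simps flip: power2_norm_eq_inner power2_eq_square)
    qed (simp add: f.zero)
    \<comment> \<open>First-order condition at the maximiser, without calculus: comparison at x + t
      y gives a linear term bounded by a quadratic one for all t. The later choice t = a / (k + 1),
      rather than a / k, also covers k = 0.\<close>
    have orth: "y \<bullet> f x = 0" if y: "y \<in> S" "y \<bullet> x = 0" for y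
    proof -
      define k where "k = M * (y \<bullet> y) - y \<bullet> f y"
      have k0: "0 \<le> k" using max[OF y(1)] by (simp add: k_def)
      have *: "2 * t * (y \<bullet> f x) \<le> t\<^sup>2 * k" for t
      proof -
        have "x + t *\<^sub>R y \<in> S" using xS y less.prems(1) by (simp add: subspace_add subspace_scale)
        from max[OF this] show ?thesis
          using y(2) nx sa[of x y]
          by (simp add: f.add f.scaleR inner_simps k_def M_def inner_commute algebra_simps power2_eq_square)
      qed
      have "\<bar>y \<bullet> f x\<bar> = 0"
      proof (rule ccontr)
        assume "\<bar>y \<bullet> f x\<bar> \<noteq> 0"
        define a where "a = y \<bullet> f x"
        have a: "0 < a\<^sup>2" using \<open>\<bar>y \<bullet> f x\<bar> \<noteq> 0\<close> by (simp add: a_def)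
        have "2 * (a / (k + 1)) * a \<le> (a / (k + 1))\<^sup>2 * k" using *[of "a / (k + 1)"] by (simp add: a_def)
        then have "2 * a\<^sup>2 * (k + 1) \<le> a\<^sup>2 * k"
          using k0 by (simp add: divide_simps power2_eq_square split: if_splits)
        then have "2 * (k + 1) \<le> k" using a by (simp add: mult.assoc mult.left_commute)
        then show False using k0 by simp
      qed
      then show ?thesis by simp
    qed
    have fx: "f x = M *\<^sub>R x"
    proof -
      define z where "z = f x - M *\<^sub>R x"
      have zS: "z \<in> S" using xS less.prems by (simp add: z_def subspace_diff subspace_scale)
      have zx: "z \<bullet> x = 0" using nx by (simp add: z_def M_def inner_simps inner_commute)
      have "z \<bullet> z = z \<bullet> f x - M * (z \<bullet> x)" by (subst (2) z_def) (simp add: inner_simps)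
      then have "z \<bullet> z = 0" using orth[OF zS zx] zx by simp
      then show ?thesis by (simp add: z_def)
    qed
    define S' where "S' = S \<inter> {y. x \<bullet> y = 0}"
    have S'sub: "subspace S'" 
      using less.prems(1) by (auto simp: S'_def subspace_def inner_simps)
    have "x \<notin> S'" "S' \<subseteq> S" using nx by (auto simp: S'_def)
    then have "S' \<subset> S" using xS by blast
    then have dim: "dim S' < dim S"
      using S'sub less.prems(1) by (metis dim_psubset span_eq_iff)
    have inv: "f y \<in> S'" if "y \<in> S'" for y
    proof -
      have "x \<bullet> f y = M * (x \<bullet> y)" using sa[of x y] fx by simp
      then show ?thesis using that less.prems(2) by (simp add: S'_def)
    qed
    have "\<exists>B. finite B \<and> B \<subseteq> S' \<and> (\<forall>b\<in>B. \<forall>c\<in>B. b \<bullet> c = (if b = c then 1 else 0)) \<and>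
       (\<forall>b\<in>B. \<exists>\<mu>. f b = \<mu> *\<^sub>R b) \<and> (\<forall>x\<in>S'. (\<Sum>b\<in>B. (b \<bullet> x) *\<^sub>R b) = x)"
      by (rule less.hyps[OF dim S'sub]) (rule inv)
    then obtain B where B0: "finite B \<and> B \<subseteq> S' \<and> (\<forall>b\<in>B. \<forall>c\<in>B. b \<bullet> c = (if b = c then 1 else 0)) \<and>
       (\<forall>b\<in>B. \<exists>\<mu>. f b = \<mu> *\<^sub>R b) \<and> (\<forall>x\<in>S'. (\<Sum>b\<in>B. (b \<bullet> x) *\<^sub>R b) = x)"
      by (elim exE)
    have B: "finite B" "B \<subseteq> S'"
      "\<And>b c. b \<in> B \<Longrightarrow> c \<in> B \<Longrightarrow> b \<bullet> c = (if b = c then 1 else 0)"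
      "\<And>b. b \<in> B \<Longrightarrow> \<exists>\<mu>. f b = \<mu> *\<^sub>R b" "\<And>y. y \<in> S' \<Longrightarrow> (\<Sum>b\<in>B. (b \<bullet> y) *\<^sub>R b) = y"
      using B0 by blast+
    have Bx: "x \<bullet> b = 0" "b \<bullet> x = 0" if "b \<in> B" for b
      using that B(2) by (auto simp: S'_def inner_commute)
    have xB: "x \<notin> B" using Bx nx by auto
    have exp: "(\<Sum>b\<in>insert x B. (b \<bullet> y) *\<^sub>R b) = y" if y: "y \<in> S" for y
    proof -
      define y' where "y' = y - (x \<bullet> y) *\<^sub>R x"
      have "y' \<in> S'" using y xS nx less.prems(1)
        by (simp add: y'_def S'_def subspace_diff subspace_scale inner_simps)
      from B(5)[OF this] have "(\<Sum>b\<in>B. (b \<bullet> y) *\<^sub>R b) = y'"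
        by (simp add: y'_def inner_simps Bx)
      then show ?thesis using B(1) xB by (simp add: y'_def)
    qed
    show ?thesis
    proof (intro exI[of _ "insert x B"] conjI ballI)
      show "\<exists>\<mu>. f b = \<mu> *\<^sub>R b" if "b \<in> insert x B" for b using that B(4) fx by auto
      show "b \<bullet> c = (if b = c then 1 else 0)" if "b \<in> insert x B" "c \<in> insert x B" for b c
        using that B(3) Bx nx xB by auto
      show "insert x B \<subseteq> S" using xS B(2) by (auto simp: S'_def)
    qed (use B exp in auto)
  qed
qed

lemma symmetric_matrix_inner:
  fixes A :: "real^'d^'d"
  assumes "transpose A = A"
  shows "(A *v x) \<bullet> y = x \<bullet> (A *v y)"
  using assms dot_lmul_matrix[of x A y] by (metis inner_commute dot_lmul_matrix vector_transpose_matrix)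

text \<open>Indexing the eigenbasis by the coordinate type, possible since it has
  \<open>CARD('d)\<close> elements, lets the eigenvalues form a diagonal matrix of the same shape as
  \<open>A\<close>.\<close>

lemma symmetric_matrix_eigenbasis:
  fixes A :: "real^'d^'d"
  assumes A: "transpose A = A"
  obtains b :: "'d \<Rightarrow> real^'d" and \<mu> where
    "\<And>i j. b i \<bullet> b j = (if i = j then 1 else 0)" "\<And>i. A *v b i = \<mu> i *\<^sub>R b i"
    "\<And>x. (\<Sum>i\<in>UNIV. (b i \<bullet> x) *\<^sub>R b i) = x"
proof -
  have "\<exists>B. finite B \<and> B \<subseteq> UNIV \<and> (\<forall>b\<in>B. \<forall>c\<in>B. b \<bullet> c = (if b = c then 1 else 0)) \<and>
       (\<forall>b\<in>B. \<exists>\<mu>. A *v b = \<mu> *\<^sub>R b) \<and> (\<forall>x\<in>UNIV. (\<Sum>b\<in>B. (b \<bullet> x) *\<^sub>R b) = x)"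
    by (rule self_adjoint_orthonormal_eigenbasis) (simp_all add: symmetric_matrix_inner[OF A])
  then obtain B where B0: "finite B \<and> B \<subseteq> UNIV \<and> (\<forall>b\<in>B. \<forall>c\<in>B. b \<bullet> c = (if b = c then 1 else 0)) \<and>
       (\<forall>b\<in>B. \<exists>\<mu>. A *v b = \<mu> *\<^sub>R b) \<and> (\<forall>x\<in>UNIV. (\<Sum>b\<in>B. (b \<bullet> x) *\<^sub>R b) = x)"
    by (elim exE)
  have B: "finite B" "\<And>b c. b \<in> B \<Longrightarrow> c \<in> B \<Longrightarrow> b \<bullet> c = (if b = c then 1 else 0)"
    "\<And>b. b \<in> B \<Longrightarrow> \<exists>\<mu>. A *v b = \<mu> *\<^sub>R b" "\<And>x. (\<Sum>b\<in>B. (b \<bullet> x) *\<^sub>R b) = x"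
    using B0 by blast+
  have "independent B"
    by (rule pairwise_orthogonal_independent)
      (use B(2) in \<open>force simp: pairwise_def orthogonal_def\<close>)+
  moreover have "x \<in> span B" for x
  proof -
    have "(\<Sum>b\<in>B. (b \<bullet> x) *\<^sub>R b) \<in> span B" by (intro span_sum span_scale span_base)
    then show ?thesis by (simp only: B(4))
  qed
  ultimately have "card B = CARD('d)"
    using dim_unique[of B UNIV "card B"] by (auto simp: dim_UNIV subset_eq)
  then obtain \<beta> :: "'d \<Rightarrow> real^'d" where \<beta>: "bij_betw \<beta> UNIV B"
    using B(1) finite_same_card_bij[of "UNIV :: 'd set" B] by auto
  have \<beta>B: "\<beta> i \<in> B" for i using \<beta> by (auto simp: bij_betw_def)
  obtain \<mu> where l: "\<And>i. A *v \<beta> i = \<mu> i *\<^sub>R \<beta> i" using B(3)[OF \<beta>B] by metis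
  show ?thesis
  proof (rule that[of \<beta> \<mu>])
    show "\<beta> i \<bullet> \<beta> j = (if i = j then 1 else 0)" for i j
      using B(2)[OF \<beta>B \<beta>B] \<beta> by (auto simp: bij_betw_def inj_eq)
    show "(\<Sum>i\<in>UNIV. (\<beta> i \<bullet> x) *\<^sub>R \<beta> i) = x" for x
      using sum.reindex_bij_betw[OF \<beta>, of "\<lambda>b. (b \<bullet> x) *\<^sub>R b"] B(4)[of x] by simp
  qed (rule l)
qed

text \<open>For D = B - C the symmetrised product D (B + C) + (B + C) D equals 2 (B^2 - C^2) = 0.
  Paired with an eigenvector of \<open>D\<close> it gives the eigenvalue times a positive number, so
  all eigenvalues of \<open>D\<close> vanish; B and C need not commute.\<close>

lemma pos_def_sqrt_unique:
  fixes B C :: "real^'d^'d"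
  assumes B: "pos_def B" and C: "pos_def C" and eq: "B ** B = C ** C"
  shows "B = C"
proof -
  have T: "transpose (B - C) = B - C"
    using B C by (simp add: pos_def_def transpose_def vec_eq_iff)
  obtain b :: "'d \<Rightarrow> real^'d" and \<mu> where b: "\<And>i j. b i \<bullet> b j = (if i = j then 1 else 0)"
    "\<And>i. (B - C) *v b i = \<mu> i *\<^sub>R b i" "\<And>x. (\<Sum>i\<in>UNIV. (b i \<bullet> x) *\<^sub>R b i) = x"
    by (rule symmetric_matrix_eigenbasis[OF T]) (rule that; assumption)
  have "\<mu> i = 0" for i
  proof -
    let ?b = "b i"
    have b0: "?b \<noteq> 0" using b(1)[of i i] by auto
    have "(B - C) *v (B *v ?b + C *v ?b) + (B *v ((B - C) *v ?b) + C *v ((B - C) *v ?b)) = 0"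
      using eq by (simp add: matrix_vector_mult_diff_rdistrib matrix_vector_mult_diff_distrib
          matrix_vector_right_distrib) (simp add: matrix_vector_mul_assoc)
    then have "?b \<bullet> ((B - C) *v (B *v ?b + C *v ?b)) + ?b \<bullet> (B *v ((B - C) *v ?b) + C *v ((B - C) *v ?b)) = 0"
      by (metis inner_add_right inner_zero_right)
    moreover have "?b \<bullet> ((B - C) *v (B *v ?b + C *v ?b)) = \<mu> i * (?b \<bullet> (B *v ?b + C *v ?b))"
      using symmetric_matrix_inner[OF T, of ?b] b(2)[of i] by (metis inner_scaleR_left)
    moreover have "?b \<bullet> (B *v ((B - C) *v ?b) + C *v ((B - C) *v ?b)) = \<mu> i * (?b \<bullet> (B *v ?b + C *v ?b))"
      by (simp add: b(2) matrix_vector_mult_scaleR inner_simps distrib_left)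
    moreover have "0 < ?b \<bullet> (B *v ?b + C *v ?b)"
      using B C b0 by (simp add: pos_def_def inner_simps add_pos_pos)
    ultimately show ?thesis by simp
  qed
  then have "(B - C) *v b i = 0" for i by (simp add: b(2))
  then have "(B - C) *v x = 0" for x
    by (subst b(3)[of x, symmetric])
      (simp add: linear_sum[OF matrix_vector_mul_linear] matrix_vector_mult_scaleR)
  then have "B - C = 0" by (simp add: matrix_eq)
  then show ?thesis by simp
qed

lemma pos_def_sqrt_exists:
  fixes A :: "real^'d^'d"
  assumes A: "pos_def A"
  shows "\<exists>B. pos_def B \<and> B ** B = A"
proof -
  have T: "transpose A = A" using A by (simp add: pos_def_def)
  obtain b :: "'d \<Rightarrow> real^'d" and \<mu> where b: "\<And>i j. b i \<bullet> b j = (if i = j then 1 else 0)"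
    "\<And>i. A *v b i = \<mu> i *\<^sub>R b i" "\<And>x. (\<Sum>i\<in>UNIV. (b i \<bullet> x) *\<^sub>R b i) = x"
    by (rule symmetric_matrix_eigenbasis[OF T]) (rule that; assumption)
  have l: "0 < \<mu> i" for i
  proof -
    have "b i \<noteq> 0" using b(1)[of i i] by auto
    then have "0 < b i \<bullet> (A *v b i)" using A by (simp add: pos_def_def)
    then show ?thesis using b(1)[of i i] by (simp add: b(2))
  qed
  define g where "g x = (\<Sum>i\<in>UNIV. (sqrt (\<mu> i) * (b i \<bullet> x)) *\<^sub>R b i)" for x
  have lin: "linear g"
    unfolding g_def by (rule linearI) (simp_all add: inner_simps algebra_simps sum.distrib scaleR_sum_right)
  have gB: "matrix g *v x = g x" for x using matrix_vector_mul(2)[OF lin] by metis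
  have inner_g: "x \<bullet> g y = (\<Sum>i\<in>UNIV. sqrt (\<mu> i) * (b i \<bullet> x) * (b i \<bullet> y))" for x y
    by (simp add: g_def inner_sum_right inner_commute mult_ac)
  have bg: "b j \<bullet> g x = sqrt (\<mu> j) * (b j \<bullet> x)" for j x
    by (simp add: inner_g b(1) if_distrib if_distribR cong: if_cong)
  have "pos_def (matrix g)"
    unfolding pos_def_def
  proof (intro conjI allI impI)
    have "(transpose (matrix g) *v x) \<bullet> y = (matrix g *v x) \<bullet> y" for x y
    proof -
      have "(transpose (matrix g) *v x) \<bullet> y = x \<bullet> g y"
        by (metis dot_lmul_matrix gB vector_transpose_matrix transpose_transpose)
      also have "\<dots> = y \<bullet> g x" by (simp add: inner_g mult_ac)
      finally show ?thesis by (simp add: gB inner_commute)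
    qed
    then have "transpose (matrix g) *v x = matrix g *v x" for x
      by (metis vector_eq_rdot)
    then show "transpose (matrix g) = matrix g" by (simp add: matrix_eq)
    fix x :: "real^'d" assume x: "x \<noteq> 0"
    obtain i where i: "b i \<bullet> x \<noteq> 0"
      using x b(3)[of x] by (metis (no_types, lifting) scaleR_zero_left sum.neutral)
    have "0 < (\<Sum>i\<in>UNIV. sqrt (\<mu> i) * (b i \<bullet> x) * (b i \<bullet> x))"
      using i l by (intro sum_pos2[of _ i]) (auto simp: mult.assoc less_imp_le zero_less_mult_iff not_less
          intro!: mult_nonneg_nonneg dest: less_imp_le)
    then show "0 < x \<bullet> (matrix g *v x)" by (simp add: gB inner_g)
  qed
  moreover have "matrix g ** matrix g = A"
  proof -
    have "A *v x = matrix g *v (matrix g *v x)" for x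
    proof -
      have "A *v x = (\<Sum>i\<in>UNIV. (b i \<bullet> x) *\<^sub>R (A *v b i))"
        by (subst b(3)[of x, symmetric])
          (simp add: linear_sum[OF matrix_vector_mul_linear] matrix_vector_mult_scaleR)
      also have "\<dots> = (\<Sum>i\<in>UNIV. (sqrt (\<mu> i) * (b i \<bullet> g x)) *\<^sub>R b i)"
      proof (rule sum.cong)
        fix i
        have "sqrt (\<mu> i) * (sqrt (\<mu> i) * (b i \<bullet> x)) = \<mu> i * (b i \<bullet> x)"
          using l[of i] by (simp flip: mult.assoc)
        then show "(b i \<bullet> x) *\<^sub>R (A *v b i) = (sqrt (\<mu> i) * (b i \<bullet> g x)) *\<^sub>R b i"
          using l[of i] by (simp add: b(2) bg mult.commute)
      qed simp
      also have "\<dots> = g (g x)" by (simp only: g_def[of "g x"])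
      finally show ?thesis by (simp add: gB)
    qed
    then show ?thesis by (simp add: matrix_eq matrix_vector_mul_assoc)
  qed
  ultimately show ?thesis by blast
qed

text \<open>Existence and uniqueness together give meaning to the definite description in the
  definition of \<open>matrix_sqrt\<close>.\<close>

lemma matrix_sqrt:
  assumes "pos_def A"
  shows "pos_def (matrix_sqrt A)" "matrix_sqrt A ** matrix_sqrt A = A"
proof -
  have "\<exists>!B. pos_def B \<and> B ** B = A"
    using pos_def_sqrt_exists[OF assms] pos_def_sqrt_unique by metis
  from theI'[OF this] show "pos_def (matrix_sqrt A)" "matrix_sqrt A ** matrix_sqrt A = A"
    by (simp_all add: matrix_sqrt_def)
qed

subsection \<open>Linear substitutions and derivatives\<close>

text \<open>Translation invariance alone determines Lebesgue measure up to a factor, so a linear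
  substitution multiplies all integrals by the same constant.\<close>
lemma nn_integral_lborel_linear_ratio:
  fixes A A' :: "'a::euclidean_space \<Rightarrow> 'a" and f g :: "'a \<Rightarrow> ennreal"
  assumes A: "linear A" and inv: "\<And>x. A (A' x) = x"
    and [measurable]: "f \<in> borel_measurable borel" "g \<in> borel_measurable borel"
  shows "(\<integral>\<^sup>+x. f (A x) \<partial>lborel) * (\<integral>\<^sup>+y. g y \<partial>lborel)
       = (\<integral>\<^sup>+x. f x \<partial>lborel) * (\<integral>\<^sup>+x. g (A x) \<partial>lborel)"
proof -
  interpret A: linear A by (rule A)
  have [measurable]: "A \<in> borel_measurable borel"
    using A by (intro borel_measurable_continuous_onI linear_continuous_on) (simp add: linear_linear)
  have "(\<integral>\<^sup>+x. f (A x) \<partial>lborel) * (\<integral>\<^sup>+y. g y \<partial>lborel)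
      = (\<integral>\<^sup>+y. (\<integral>\<^sup>+x. f (A x) * g y \<partial>lborel) \<partial>lborel)"
    by (simp add: nn_integral_cmult nn_integral_multc)
  also have "\<dots> = (\<integral>\<^sup>+y. (\<integral>\<^sup>+x. f (y + A x) * g y \<partial>lborel) \<partial>lborel)"
  proof (rule nn_integral_cong)
    fix y
    show "(\<integral>\<^sup>+x. f (A x) * g y \<partial>lborel) = (\<integral>\<^sup>+x. f (y + A x) * g y \<partial>lborel)"
      by (subst nn_integral_lborel_affine[of _ 1 "A' y"]) (simp_all add: A.add inv)
  qed
  also have "\<dots> = (\<integral>\<^sup>+x. (\<integral>\<^sup>+y. f (y + A x) * g y \<partial>lborel) \<partial>lborel)"
    by (rule lborel_pair.Fubini') simp
  also have "\<dots> = (\<integral>\<^sup>+x. (\<integral>\<^sup>+y. f y * g (y - A x) \<partial>lborel) \<partial>lborel)"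
  proof (rule nn_integral_cong)
    fix x
    show "(\<integral>\<^sup>+y. f (y + A x) * g y \<partial>lborel) = (\<integral>\<^sup>+y. f y * g (y - A x) \<partial>lborel)"
      by (subst nn_integral_lborel_affine[of _ 1 "- A x"]) simp_all
  qed
  also have "\<dots> = (\<integral>\<^sup>+y. (\<integral>\<^sup>+x. f y * g (y - A x) \<partial>lborel) \<partial>lborel)"
    by (rule lborel_pair.Fubini') simp
  also have "\<dots> = (\<integral>\<^sup>+y. (\<integral>\<^sup>+x. f y * g (A x) \<partial>lborel) \<partial>lborel)"
  proof (rule nn_integral_cong)
    fix y
    \<comment> \<open>The reflection of \<open>x\<close> to A' y - x turns y - A x into A x, which
      separates the two integrals.\<close>
    show "(\<integral>\<^sup>+x. f y * g (y - A x) \<partial>lborel) = (\<integral>\<^sup>+x. f y * g (A x) \<partial>lborel)"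
      by (subst nn_integral_lborel_affine[of _ "-1" "A' y"]) (simp_all add: A.diff A.neg inv)
  qed
  also have "\<dots> = (\<integral>\<^sup>+x. f x \<partial>lborel) * (\<integral>\<^sup>+x. g (A x) \<partial>lborel)"
    by (simp add: nn_integral_cmult nn_integral_multc)
  finally show ?thesis .
qed

text \<open>The unknown common factor is read off from the Gaussian, which an isometry does not
  change; its integral is positive and finite, so it can be cancelled.\<close>

lemma nn_integral_lborel_orthogonal:
  fixes A A' :: "'a::euclidean_space \<Rightarrow> 'a" and f :: "'a \<Rightarrow> ennreal"
  assumes A: "linear A" "\<And>x. A (A' x) = x" "\<And>x. norm (A x) = norm x"
    and f: "f \<in> borel_measurable borel"
  shows "(\<integral>\<^sup>+x. f (A x) \<partial>lborel) = (\<integral>\<^sup>+x. f x \<partial>lborel)"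
proof -
  define k where "k = sqrt pi ^ DIM('a)"
  have k: "k > 0" by (simp add: k_def)
  have "(\<integral>\<^sup>+x. f (A x) \<partial>lborel) * ennreal k = (\<integral>\<^sup>+x. f x \<partial>lborel) * ennreal k"
    using nn_integral_lborel_linear_ratio[OF A(1,2) f, of "\<lambda>x. ennreal (exp (- (1 * (norm x)\<^sup>2)))"]
      nn_integral_lborel_gaussian[of 1, where 'a = 'a] by (simp add: A(3) k_def)
  then have "(\<integral>\<^sup>+x. f (A x) \<partial>lborel) * ennreal k * ennreal (1 / k)
      = (\<integral>\<^sup>+x. f x \<partial>lborel) * ennreal k * ennreal (1 / k)" by simp
  moreover have "ennreal k * ennreal (1 / k) = 1" using k by (simp flip: ennreal_mult'')
  ultimately show ?thesis by (simp add: mult.assoc)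
qed

lemma Basis_cart: "(Basis :: (real^'d) set) = range (\<lambda>i. axis i 1)"
  by (auto simp: Basis_vec_def)

lemma prod_Basis_cart: "(\<Prod>b\<in>(Basis :: (real^'d) set). F b) = (\<Prod>i\<in>UNIV. F (axis i 1))"
  unfolding Basis_cart by (subst prod.reindex) (auto simp: inj_def axis_eq_axis)

text \<open>Diagonalising \<open>A\<close> in an orthonormal basis reduces to a product of one-dimensional integrals.\<close>
lemma nn_integral_lborel_pos_def_gaussian:
  fixes A :: "real^'d^'d"
  assumes A: "pos_def A"
  shows "0 < det A"
    and "(\<integral>\<^sup>+x. ennreal (exp (- (x \<bullet> (A *v x)) / 2)) \<partial>lborel) = ennreal (sqrt ((2 * pi) ^ CARD('d) / det A))"
proof -
  have T: "transpose A = A" using A by (simp add: pos_def_def)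
  obtain b :: "'d \<Rightarrow> real^'d" and \<mu> where b: "\<And>i j. b i \<bullet> b j = (if i = j then 1 else 0)"
    "\<And>i. A *v b i = \<mu> i *\<^sub>R b i" "\<And>x. (\<Sum>i\<in>UNIV. (b i \<bullet> x) *\<^sub>R b i) = x"
    by (rule symmetric_matrix_eigenbasis[OF T]) (rule that; assumption)
  have \<mu>: "0 < \<mu> i" for i
  proof -
    have "b i \<noteq> 0" using b(1)[of i i] by auto
    then have "0 < b i \<bullet> (A *v b i)" using A by (simp add: pos_def_def)
    then show ?thesis using b(1)[of i i] by (simp add: b(2))
  qed
  define g where "g x = (\<Sum>i\<in>UNIV. (x $ i) *\<^sub>R b i)" for x :: "real^'d"
  define g' where "g' x = (\<chi> i. b i \<bullet> x)" for x
  have lin: "linear g"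
    unfolding g_def by (rule linearI) (simp_all add: algebra_simps sum.distrib scaleR_sum_right)
  have lin': "linear g'"
    unfolding g'_def by (rule linearI) (simp_all add: vec_eq_iff inner_simps)
  have gg': "g (g' x) = x" for x by (simp add: g_def g'_def b(3))
  have bg: "b i \<bullet> g x = x $ i" for i x
    by (simp add: g_def inner_sum_right b(1) if_distrib cong: if_cong)
  have inner_g: "y \<bullet> g x = (\<Sum>i\<in>UNIV. (b i \<bullet> y) * x $ i)" for x y
    by (simp add: g_def inner_sum_right inner_commute mult.commute)
  have norm_g: "norm (g x) = norm x" for x
    unfolding norm_eq_sqrt_inner by (subst inner_g) (simp add: bg inner_vec_def[of x x])
  have Ag: "A *v g x = g (\<chi> i. \<mu> i * x $ i)" for x
    unfolding g_def
    by (simp add: linear_sum[OF matrix_vector_mul_linear] matrix_vector_mult_scaleR b(2) mult.commute)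
  have quad: "g x \<bullet> (A *v g x) = (\<Sum>i\<in>UNIV. \<mu> i * (x $ i)\<^sup>2)" for x
    unfolding Ag by (subst inner_g) (simp add: bg power2_eq_square mult_ac)

  define D :: "real^'d^'d" where "D = (\<chi> i j. if i = j then \<mu> i else 0)"
  have Dv: "D *v x = (\<chi> i. \<mu> i * x $ i)" for x
    by (simp add: D_def matrix_vector_mult_def vec_eq_iff if_distrib if_distribR cong: if_cong)
  have gm: "matrix g *v x = g x" "matrix g' *v x = g' x" for x
    using matrix_vector_mul(2)[OF lin] matrix_vector_mul(2)[OF lin'] by metis+
  \<comment> \<open>The determinant of \<open>A\<close> comes from similarity to \<open>D\<close>;
    invertibility of \<open>matrix g\<close> suffices, and its determinant is never
    computed.\<close>
  have "A ** matrix g = matrix g ** D"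
    by (simp add: matrix_eq gm Ag Dv flip: matrix_vector_mul_assoc)
  then have "det A * det (matrix g) = det (matrix g) * det D" by (metis det_mul)
  moreover have "matrix g ** matrix g' = mat 1"
    by (simp add: matrix_eq gm gg' flip: matrix_vector_mul_assoc)
  then have "det (matrix g) \<noteq> 0" by (metis det_I det_mul mult_zero_left zero_neq_one)
  ultimately have detA: "det A = (\<Prod>i\<in>UNIV. \<mu> i)"
    by (simp add: det_diagonal D_def)
  then show "0 < det A" by (simp add: \<mu> prod_pos)

  \<comment> \<open>The product formula for integrals is indexed by basis vectors, so the
    eigenvalues are encoded as a function on vectors that takes the value \<mu> i / 2 at the i-th
    axis.\<close>
  define c where "c e = (\<Sum>i\<in>UNIV. \<mu> i / 2 * (e $ i)\<^sup>2)" for e :: "real^'d"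
  have c: "c (axis i 1) = \<mu> i / 2" for i
    by (simp add: c_def axis_def if_distrib if_distribR cong: if_cong)
  have [measurable]: "(\<lambda>x. A *v x) \<in> borel_measurable borel"
    by (intro borel_measurable_continuous_onI linear_continuous_on matrix_vector_mul_bounded_linear)
  have "(\<integral>\<^sup>+x. ennreal (exp (- (x \<bullet> (A *v x)) / 2)) \<partial>lborel)
     = (\<integral>\<^sup>+x. ennreal (exp (- (g x \<bullet> (A *v g x)) / 2)) \<partial>lborel)"
    by (rule nn_integral_lborel_orthogonal[OF lin gg' norm_g, symmetric])
      measurable
  also have "\<dots> = (\<integral>\<^sup>+x. (\<Prod>e\<in>Basis. ennreal (exp (- (c e * (x \<bullet> e)\<^sup>2)))) \<partial>lborel)"
  proof (rule nn_integral_cong)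
    fix x :: "real^'d"
    show "ennreal (exp (- (g x \<bullet> (A *v g x)) / 2))
      = (\<Prod>e\<in>Basis. ennreal (exp (- (c e * (x \<bullet> e)\<^sup>2))))"
      by (simp add: quad prod_Basis_cart c inner_axis prod_ennreal exp_sum[symmetric] sum_negf
          sum_divide_distrib)
  qed
  also have "\<dots> = (\<Prod>e\<in>(Basis :: (real^'d) set). \<integral>\<^sup>+y. ennreal (exp (- (c e * y\<^sup>2))) \<partial>lborel)"
    by (rule nn_integral_lborel_prod) auto
  also have "\<dots> = (\<Prod>i\<in>UNIV. ennreal (sqrt (pi / (\<mu> i / 2))))"
    unfolding prod_Basis_cart
  proof (rule prod.cong)
    fix i :: 'd
    show "(\<integral>\<^sup>+y. ennreal (exp (- (c (axis i 1) * y\<^sup>2))) \<partial>lborel)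
       = ennreal (sqrt (pi / (\<mu> i / 2)))"
      unfolding c using \<mu>[of i] by (intro nn_integral_lborel_gaussian_real) simp
  qed simp
  also have "\<dots> = ennreal (\<Prod>i\<in>UNIV. sqrt (pi / (\<mu> i / 2)))"
    using \<mu> by (intro prod_ennreal) (simp add: less_imp_le)
  also have "(\<Prod>i\<in>UNIV. sqrt (pi / (\<mu> i / 2))) = sqrt ((2 * pi) ^ CARD('d) / det A)"
  proof (rule real_sqrt_unique[symmetric])
    have "(\<Prod>i\<in>UNIV. sqrt (pi / (\<mu> i / 2)))\<^sup>2 = (\<Prod>i\<in>UNIV. (2 * pi) / \<mu> i)"
      using \<mu> by (simp add: prod_power_distrib less_imp_le mult.commute)
    also have "\<dots> = (2 * pi) ^ CARD('d) / det A" by (simp add: prod_dividef detA)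
    finally show "(\<Prod>i\<in>UNIV. sqrt (pi / (\<mu> i / 2)))\<^sup>2 = (2 * pi) ^ CARD('d) / det A" .
  qed (use \<mu> in \<open>simp add: prod_nonneg less_imp_le\<close>)
  finally show "(\<integral>\<^sup>+x. ennreal (exp (- (x \<bullet> (A *v x)) / 2)) \<partial>lborel)
     = ennreal (sqrt ((2 * pi) ^ CARD('d) / det A))" .
qed

section \<open>Derivatives at interior points and measurability of convex sets\<close>

lemma has_derivative_gradient_within:
  fixes f :: "real^'d \<Rightarrow> real"
  assumes f: "f differentiable (at x within S)" and x: "x \<in> interior S"
  shows "(f has_derivative (\<lambda>h. gradient_within S f x \<bullet> h)) (at x)"
proof -
  have ax: "at x within S = at x" using x by (rule at_within_interior)
  define f' where "f' = frechet_derivative f (at x)"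
  have f': "(f has_derivative f') (at x)"
    using f unfolding ax f'_def by (simp add: frechet_derivative_works)
  then interpret f': linear f' by (rule has_derivative_linear)
  have "f' h = gradient_within S f x \<bullet> h" for h
  proof -
    have "f' h = f' (\<Sum>i\<in>UNIV. (h $ i) *\<^sub>R axis i 1)"
      using basis_expansion[of h] by (simp add: scalar_mult_eq_scaleR)
    also have "\<dots> = (\<Sum>i\<in>UNIV. h $ i * f' (axis i 1))" by (simp add: f'.sum f'.scaleR)
    also have "\<dots> = gradient_within S f x \<bullet> h"
      by (simp add: gradient_within_def ax f'_def inner_vec_def mult.commute)
    finally show ?thesis .
  qed
  then have "f' = (\<lambda>h. gradient_within S f x \<bullet> h)" by (simp add: fun_eq_iff)
  with f' show ?thesis by simp
qed

lemma has_derivative_hessian_within: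
  fixes f :: "real^'d \<Rightarrow> real"
  assumes f: "gradient_within S f differentiable (at x within S)" and x: "x \<in> interior S"
  shows "(gradient_within S f has_derivative (\<lambda>h. hessian_within S f x *v h)) (at x)"
proof -
  have ax: "at x within S = at x" using x by (rule at_within_interior)
  have f': "(gradient_within S f has_derivative frechet_derivative (gradient_within S f) (at x)) (at x)"
    using f unfolding ax by (simp add: frechet_derivative_works)
  show ?thesis
    using f' matrix_vector_mul(2)[OF has_derivative_linear[OF f']]
    unfolding hessian_within_def ax by simp
qed

text \<open>A convex set exceeds its interior only by part of its frontier, which is
  negligible.\<close>

lemma sets_lebesgue_convex:
  fixes S :: "'a::euclidean_space set"
  assumes "convex S"
  shows "S \<in> sets lebesgue"
proof -
  have "negligible (S - interior S)"
    using negligible_convex_frontier[OF assms] closure_subset[of S]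
    by (rule_tac negligible_subset) (auto simp: frontier_def)
  then have "interior S \<union> (S - interior S) \<in> sets lebesgue"
    by (intro sets.Un) (auto simp: negligible_imp_sets)
  then show ?thesis using interior_subset[of S] by (simp add: Un_absorb1)
qed

subsection \<open>Transfer to the original coordinates\<close>

text \<open>The real number \<open>\<delta>\<close> stands for the extended real supremum once that
  is known to be finite, and \<open>\<delta>_bound\<close> is the supremum with the quotient
  multiplied out. This keeps extended reals out of the analysis.\<close>

locale laplace_setting =
  fixes \<Theta> :: "(real^'d) set" and f :: "real^'d \<Rightarrow> real" and m :: "real^'d"
    and H :: "real^'d^'d" and n r \<delta> :: real
  assumes convex_\<Theta>: "convex \<Theta>" and n_pos: "0 < n" and C2: "C2_on \<Theta> f" and convex_f: "convex_on \<Theta> f"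
    and min: "strict_global_minimizer \<Theta> f m" and pd_H: "pos_def H"
    and r_ge: "6 \<le> r" and region: "local_region n H m r \<subseteq> \<Theta>"
    and \<delta>_nonneg: "0 \<le> \<delta>" and r\<delta>: "r * \<delta> * sqrt (CARD('d) / n) \<le> 1 / 2"
    and \<delta>_bound: "\<And>x. x \<in> local_region n H m r \<Longrightarrow> x \<noteq> m \<Longrightarrow>
      mat_norm_wrt H (hessian_within \<Theta> f x - H) \<le> \<delta> * vec_norm_wrt H (x - m)"
begin

definition "K = matrix_sqrt H"
definition "J = matrix_inv K"
definition "R = r * sqrt (CARD('d))"

lemma K: "pos_def K" "K ** K = H" "transpose K = K"
  using matrix_sqrt[OF pd_H] by (auto simp: K_def pos_def_def)

lemma KJ: "K ** J = mat 1" "J ** K = mat 1"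
proof -
  have "K *v x = 0 \<Longrightarrow> x = 0" for x using K(1) by (auto simp: pos_def_def)
  then have "invertible K" by (metis invertible_left_inverse matrix_left_invertible_ker)
  then have "\<exists>J. K ** J = mat 1 \<and> J ** K = mat 1" by (simp add: invertible_def)
  then show "K ** J = mat 1" "J ** K = mat 1"
    unfolding J_def matrix_inv_def by (metis (mono_tags, lifting) someI_ex)+
qed

lemma KJv: "K *v (J *v x) = x" "J *v (K *v x) = x"
  using KJ by (simp_all add: matrix_vector_mul_assoc)

lemma J_sym: "(J *v x) \<bullet> y = x \<bullet> (J *v y)"
  by (metis KJv(1) symmetric_matrix_inner[OF K(3)])

lemma H_mult: "H *v x = K *v (K *v x)"
  by (simp add: matrix_vector_mul_assoc K(2))

lemma H_inner: "x \<bullet> (H *v x) = (norm (K *v x))\<^sup>2"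
  using symmetric_matrix_inner[OF K(3), of x "K *v x"]
  by (simp add: power2_norm_eq_inner matrix_vector_mul_assoc K(2))

lemma R_pos: "0 < R" using r_ge by (simp add: R_def)

text \<open>This is the inverse square root of n H, with inverse \<open>A'\<close>. The chart
  \<open>T\<close> carries the closed ball of radius \<open>R\<close> to the local region and the
  standard Gaussian to the Laplace approximation.\<close>

definition A :: "real^'d \<Rightarrow> real^'d" where "A x = (1 / sqrt n) *\<^sub>R (J *v x)"
definition A' :: "real^'d \<Rightarrow> real^'d" where "A' x = sqrt n *\<^sub>R (K *v x)"
definition T :: "real^'d \<Rightarrow> real^'d" where "T x = m + A x"

lemma linear_A: "linear A"
  unfolding A_def by (rule linearI) (simp_all add: matrix_vector_right_distrib matrix_vector_mult_scaleR algebra_simps)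

lemma AA': "A (A' x) = x" "A' (A x) = x"
  using n_pos by (simp_all add: A_def A'_def matrix_vector_mult_scaleR KJv)

lemma bounded_linear_A: "bounded_linear A"
  using linear_A by (simp add: linear_conv_bounded_linear)

lemma T_deriv: "(T has_derivative A) (at x within S)"
proof -
  have "(A has_derivative A) (at x within S)"
    using bounded_linear_A by (rule bounded_linear_imp_has_derivative)
  then show ?thesis unfolding T_def[abs_def] by (auto intro!: derivative_eq_intros)
qed

lemma T_cont: "continuous_on S T"
  using T_deriv by (rule has_derivative_continuous_on)

lemma borel_T [measurable]: "T \<in> borel_measurable borel"
  by (rule borel_measurable_continuous_onI) (rule T_cont)

lemma T_region: "norm x \<le> R \<Longrightarrow> T x \<in> local_region n H m r"
  and vec_norm_T: "vec_norm_wrt H (T x - m) = norm x / sqrt n"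
proof -
  show *: "vec_norm_wrt H (T x - m) = norm x / sqrt n"
    using n_pos by (simp add: vec_norm_wrt_def T_def A_def matrix_vector_mult_scaleR KJv flip: K_def)
  show "T x \<in> local_region n H m r" if "norm x \<le> R"
    using that n_pos unfolding local_region_def mem_Collect_eq *
    by (simp add: R_def real_sqrt_divide divide_right_mono)
qed

text \<open>The interior is taken to obtain an open domain; no mass is lost, since the frontier of a
  convex set is null.\<close>

definition "\<Omega> = T -` interior \<Theta>"

text \<open>The local region may touch the frontier of \<open>\<Theta>\<close>, but the image of the
  open ball is an open subset of \<open>\<Theta>\<close> and therefore lies in the interior.\<close>

lemma ball_\<Omega>: "ball 0 R \<subseteq> \<Omega>"
proof -
  have "T ` ball 0 R \<subseteq> \<Theta>" using T_region region by force
  moreover have "open (T ` ball 0 R)"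
  proof -
    have "T ` ball 0 R = (\<lambda>y. A' (y - m)) -` ball 0 R"
    proof safe
      fix x assume "A' (x - m) \<in> ball 0 R"
      then show "x \<in> T ` ball 0 R" by (intro image_eqI[of _ _ "A' (x - m)"]) (auto simp: T_def AA')
    qed (simp add: T_def AA')
    moreover have "continuous_on UNIV (\<lambda>y. A' (y - m))"
      unfolding A'_def
      by (intro continuous_intros continuous_on_compose2[OF linear_continuous_on[OF matrix_vector_mul_bounded_linear]]) auto
    ultimately show ?thesis by (simp add: open_vimage)
  qed
  ultimately show ?thesis by (auto simp: \<Omega>_def interior_def)
qed

lemma open_\<Omega>: "open \<Omega>"
  unfolding \<Omega>_def using T_cont by (intro open_vimage) auto

definition "V x = n * (f (T x) - f m)"
definition "v x = sqrt n *\<^sub>R (J *v gradient_within \<Theta> f (T x))"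
definition "L = \<delta> / sqrt n"

lemma interior_T: "norm x < R \<Longrightarrow> T x \<in> interior \<Theta>"
  using ball_\<Omega> by (auto simp: \<Omega>_def)

lemma T0: "T 0 = m" by (simp add: T_def A_def)

lemma V_deriv:
  assumes "norm x < R"
  shows "(V has_derivative (\<lambda>h. v x \<bullet> h)) (at x)"
proof -
  have i: "T x \<in> interior \<Theta>" using interior_T[OF assms] .
  have "(f has_derivative (\<lambda>h. gradient_within \<Theta> f (T x) \<bullet> h)) (at (T x))"
    using C2 i interior_subset[of \<Theta>]
    by (intro has_derivative_gradient_within) (auto simp: C2_on_def differentiable_on_def)
  from has_derivative_compose[OF T_deriv this]
  have "((\<lambda>x. f (T x)) has_derivative (\<lambda>h. gradient_within \<Theta> f (T x) \<bullet> A h)) (at x)" .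
  then have "(V has_derivative (\<lambda>h. n * (gradient_within \<Theta> f (T x) \<bullet> A h))) (at x)"
    unfolding V_def[abs_def] by (auto intro!: derivative_eq_intros)
  moreover have "n * (gradient_within \<Theta> f (T x) \<bullet> A h) = v x \<bullet> h" for h
  proof -
    have "n * (gradient_within \<Theta> f (T x) \<bullet> A h) = (n / sqrt n) * (gradient_within \<Theta> f (T x) \<bullet> (J *v h))"
      by (simp add: A_def)
    also have "n / sqrt n = sqrt n" using n_pos by (simp add: real_div_sqrt)
    finally show ?thesis by (simp add: v_def J_sym)
  qed
  ultimately show ?thesis by simp
qed

lemma v_deriv:
  assumes "norm x < R"
  shows "(v has_derivative (\<lambda>h. J *v (hessian_within \<Theta> f (T x) *v (J *v h)))) (at x)"
proof -
  have i: "T x \<in> interior \<Theta>" using interior_T[OF assms] .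
  have "(gradient_within \<Theta> f has_derivative (\<lambda>h. hessian_within \<Theta> f (T x) *v h)) (at (T x))"
    using C2 i interior_subset[of \<Theta>]
    by (intro has_derivative_hessian_within) (auto simp: C2_on_def differentiable_on_def)
  from has_derivative_compose[OF T_deriv this]
  have g: "((\<lambda>x. gradient_within \<Theta> f (T x)) has_derivative (\<lambda>h. hessian_within \<Theta> f (T x) *v A h)) (at x)" .
  have "(v has_derivative (\<lambda>h. sqrt n *\<^sub>R (J *v (hessian_within \<Theta> f (T x) *v A h)))) (at x)"
    unfolding v_def[abs_def]
    by (intro has_derivative_scaleR_right bounded_linear.has_derivative[OF matrix_vector_mul_bounded_linear g])
  then show ?thesis using n_pos by (simp add: A_def matrix_vector_mult_scaleR)
qed

lemma v0: "v 0 = 0"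
proof -
  have m: "m \<in> interior \<Theta>" using interior_T[of 0] R_pos by (simp add: T0)
  have "(f has_derivative (\<lambda>h. gradient_within \<Theta> f m \<bullet> h)) (at m)"
    using C2 m interior_subset[of \<Theta>]
    by (intro has_derivative_gradient_within) (auto simp: C2_on_def differentiable_on_def)
  moreover have "\<forall>y\<in>interior \<Theta>. f m \<le> f y"
    using min interior_subset[of \<Theta>] unfolding strict_global_minimizer_def by force
  ultimately have "(\<lambda>h. gradient_within \<Theta> f m \<bullet> h) = (\<lambda>h. 0)"
    using m by (intro differential_zero_maxmin[of m "interior \<Theta>" f]) auto
  then have "gradient_within \<Theta> f m = 0" by (metis inner_eq_zero_iff)
  then show ?thesis by (simp add: v_def T0)
qed

text \<open>Along the ray to \<open>x\<close> the function v - id starts at 0, and its derivative is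
  the whitened Hessian increment \<open>E t\<close> applied to \<open>x\<close>. The operator norm
  of \<open>E t\<close> is the \<open>H\<close>-norm of the increment, at most L t |x|; integrating
  t over the unit interval gives the 1/2. The factor 1 / sqrt n in \<open>L\<close> comes from
  \<open>vec_norm_T\<close>.\<close>

lemma v_near:
  assumes x: "norm x < R"
  shows "norm (v x - x) \<le> L / 2 * (norm x)\<^sup>2"
proof -
  define E where "E t = J ** (hessian_within \<Theta> f (T (t *\<^sub>R x)) - H) ** J" for t
  have tx: "norm (t *\<^sub>R x) < R" if "0 \<le> t" "t \<le> 1" for t
    using that x mult_left_le_one_le[of "norm x" t] by auto
  have d: "((\<lambda>t. v (t *\<^sub>R x) - t *\<^sub>R x) has_vector_derivative E t *v x) (at t)" if t: "0 \<le> t" "t \<le> 1" for t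
  proof -
    have "((\<lambda>t. t *\<^sub>R x) has_derivative (\<lambda>h. h *\<^sub>R x)) (at t)" by (auto intro!: derivative_eq_intros)
    from has_derivative_compose[OF this v_deriv[OF tx[OF t]]]
    have 1: "((\<lambda>t. v (t *\<^sub>R x)) has_derivative
       (\<lambda>h. h *\<^sub>R (J *v (hessian_within \<Theta> f (T (t *\<^sub>R x)) *v (J *v x))))) (at t)"
      by (simp add: matrix_vector_mult_scaleR)
    \<comment> \<open>Whitening turns the Hessian at the minimiser into the identity, which matches
      the derivative of the subtracted term.\<close>
    have "J *v (H *v (J *v x)) = x" by (simp add: H_mult KJv)
    then have "E t *v x = J *v (hessian_within \<Theta> f (T (t *\<^sub>R x)) *v (J *v x)) - x"
      by (simp add: E_def matrix_vector_mult_diff_rdistrib matrix_vector_mult_diff_distrib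
          flip: matrix_vector_mul_assoc)
    with 1 show ?thesis unfolding has_vector_derivative_def
      by (auto intro!: derivative_eq_intros simp: scaleR_diff_right)
  qed
  \<comment> \<open>Only t > 0 is available because the supremum leaves out the minimiser; the mean
    value inequality needs no bound at the endpoints.\<close>
  have bnd: "norm (E t *v x) \<le> L * (norm x)\<^sup>2 * t" if t: "0 < t" "t < 1" for t
  proof (cases "x = 0")
    case False
    have "T (t *\<^sub>R x) \<noteq> m"
      using vec_norm_T[of "t *\<^sub>R x"] False t n_pos by (auto simp: vec_norm_wrt_def)
    moreover have "T (t *\<^sub>R x) \<in> local_region n H m r"
      using tx[of t] t by (intro T_region) auto
    ultimately have "onorm ((*v) (E t)) \<le> \<delta> * (norm (t *\<^sub>R x) / sqrt n)"
      using \<delta>_bound unfolding mat_norm_wrt_def vec_norm_T[symmetric] E_def J_def K_def by blast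
    then have "norm (E t *v x) \<le> \<delta> * (norm (t *\<^sub>R x) / sqrt n) * norm x"
      using onorm[OF matrix_vector_mul_bounded_linear, of "E t" x]
      by (meson mult_right_mono norm_ge_zero order_trans)
    then show ?thesis using t by (simp add: L_def power2_eq_square mult_ac)
  qed simp
  have "norm ((v (1 *\<^sub>R x) - 1 *\<^sub>R x) - (v (0 *\<^sub>R x) - 0 *\<^sub>R x))
      \<le> L / 2 * (norm x)\<^sup>2 * 1\<^sup>2 - L / 2 * (norm x)\<^sup>2 * 0\<^sup>2"
  proof (rule differentiable_bound_general[where f' = "\<lambda>t. E t *v x" and \<phi>' = "\<lambda>t. L * (norm x)\<^sup>2 * t"
        and \<phi> = "\<lambda>t. L / 2 * (norm x)\<^sup>2 * t\<^sup>2" and f = "\<lambda>t. v (t *\<^sub>R x) - t *\<^sub>R x"])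
    show "continuous_on {0..1} (\<lambda>t. v (t *\<^sub>R x) - t *\<^sub>R x)"
      using d by (intro continuous_at_imp_continuous_on ballI has_vector_derivative_continuous) auto
    show "((\<lambda>t. L / 2 * (norm x)\<^sup>2 * t\<^sup>2) has_vector_derivative L * (norm x)\<^sup>2 * t) (at t)" for t
      unfolding has_real_derivative_iff_has_vector_derivative[symmetric]
      by (auto intro!: derivative_eq_intros)
  qed (use d bnd in \<open>auto intro!: continuous_intros\<close>)
  then show ?thesis by (simp add: v0)
qed

lemma V_convex: "convex_on \<Omega> V"
proof -
  have Tc: "T (u *\<^sub>R x + w *\<^sub>R y) = u *\<^sub>R T x + w *\<^sub>R T y" if "u + w = 1" for u w x y
  proof -
    have "u *\<^sub>R T x + w *\<^sub>R T y = (u + w) *\<^sub>R m + (u *\<^sub>R A x + w *\<^sub>R A y)"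
      by (simp add: T_def algebra_simps)
    then show ?thesis using that
      by (simp add: T_def linear_add[OF linear_A] linear_scale[OF linear_A])
  qed
  have "convex (interior \<Theta>)" using convex_\<Theta> by (rule convex_interior)
  then have "convex \<Omega>" unfolding convex_def \<Omega>_def by (auto simp: Tc)
  moreover have "V (u *\<^sub>R x + w *\<^sub>R y) \<le> u * V x + w * V y"
    if "x \<in> \<Omega>" "y \<in> \<Omega>" "0 \<le> u" "0 \<le> w" "u + w = 1" for x y u w
  proof -
    have "T x \<in> \<Theta>" "T y \<in> \<Theta>" using that interior_subset[of \<Theta>] by (auto simp: \<Omega>_def)
    then have "f (T (u *\<^sub>R x + w *\<^sub>R y)) \<le> u * f (T x) + w * f (T y)"
      using convex_f that unfolding convex_on_def by (simp add: Tc)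
    then have "n * f (T (u *\<^sub>R x + w *\<^sub>R y)) \<le> n * (u * f (T x) + w * f (T y))"
      using n_pos by (intro mult_left_mono) auto
    moreover have "u * (n * f m) + w * (n * f m) = n * f m"
      using that(5) by (simp flip: distrib_right)
    ultimately show ?thesis by (simp add: V_def algebra_simps)
  qed
  ultimately show ?thesis by (simp add: convex_on_def)
qed

sublocale ng: near_gaussian \<Omega> V v R L r
proof
  show "open \<Omega>" "convex_on \<Omega> V" "ball 0 R \<subseteq> \<Omega>" "6 \<le> r"
    by (fact open_\<Omega> V_convex ball_\<Omega> r_ge)+
  show "V 0 = 0" by (simp add: V_def T0)
  show "R = r * sqrt (DIM(real^'d))" by (simp add: R_def)
  show "(V has_derivative (\<lambda>h. v x \<bullet> h)) (at x)" "norm (v x - x) \<le> L / 2 * (norm x)\<^sup>2" if "norm x < R" for x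
    using V_deriv[OF that] v_near[OF that] .
  show "continuous_on (ball 0 R) v"
    by (intro continuous_at_imp_continuous_on ballI has_derivative_continuous[OF v_deriv]) auto
  show "0 \<le> L" using \<delta>_nonneg n_pos by (simp add: L_def)
  show "L * R \<le> 1 / 2" using r\<delta> by (simp add: L_def R_def real_sqrt_divide mult_ac)
qed

section \<open>Gaussian and Gibbs measures in normalised coordinates\<close>

lemma pd_nH: "pos_def (n *\<^sub>R H)"
  using pd_H n_pos by (simp add: pos_def_def transpose_scalar flip: scaleR_matrix_vector_assoc)

definition "N = sqrt ((2 * pi) ^ CARD('d) / det (n *\<^sub>R H))"

lemma N_pos: "0 < N"
  using nn_integral_lborel_pos_def_gaussian(1)[OF pd_nH] by (simp add: N_def)

definition G :: "real^'d \<Rightarrow> real" where "G y = exp (- (y \<bullet> ((n *\<^sub>R H) *v y)) / 2)"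

lemma borel_G [measurable]: "G \<in> borel_measurable borel"
proof -
  have [measurable]: "(\<lambda>x. (n *\<^sub>R H) *v x) \<in> borel_measurable borel"
    by (intro borel_measurable_continuous_onI linear_continuous_on matrix_vector_mul_bounded_linear)
  show ?thesis unfolding G_def by measurable
qed

lemma G_A: "G (A x) = exp (- (norm x)\<^sup>2 / 2)"
proof -
  have "A x \<bullet> ((n *\<^sub>R H) *v A x) = n * (norm (K *v A x))\<^sup>2"
    by (simp add: H_inner flip: scaleR_matrix_vector_assoc)
  also have "\<dots> = (norm x)\<^sup>2"
    using n_pos by (simp add: A_def matrix_vector_mult_scaleR KJv power_divide)
  finally show ?thesis by (simp add: G_def)
qed

text \<open>The Jacobian of \<open>T\<close>, expressed as a ratio of Gaussian normalisations. In
  \<open>nn_integral_T\<close> the scaling factor of the linear substitution is calibrated on the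
  Gaussian, so no determinant of \<open>A\<close> is needed.\<close>

definition "\<kappa> = N / sqrt (2 * pi) ^ CARD('d)"

lemma \<kappa>_pos: "0 < \<kappa>" using N_pos by (simp add: \<kappa>_def)

lemma nn_integral_T:
  assumes [measurable]: "g \<in> borel_measurable borel"
  shows "(\<integral>\<^sup>+\<theta>. g \<theta> \<partial>lborel) = ennreal \<kappa> * (\<integral>\<^sup>+x. g (T x) \<partial>lborel)"
proof -
  define S where "S = sqrt (2 * pi) ^ CARD('d)"
  have S: "0 < S" by (simp add: S_def)
  have GA: "(\<integral>\<^sup>+x. ennreal (G (A x)) \<partial>lborel) = ennreal S"
    using nn_integral_lborel_gaussian[of "1/2", where 'a = "real^'d"]
    by (simp add: G_A S_def mult.commute)
  have GN: "(\<integral>\<^sup>+x. ennreal (G x) \<partial>lborel) = ennreal N"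
    unfolding G_def N_def by (rule nn_integral_lborel_pos_def_gaussian(2)[OF pd_nH])
  have "(\<integral>\<^sup>+x. g (m + A x) \<partial>lborel) * ennreal N = (\<integral>\<^sup>+x. g (m + x) \<partial>lborel) * ennreal S"
    using nn_integral_lborel_linear_ratio[OF linear_A AA'(1), of "\<lambda>x. g (m + x)" "\<lambda>x. ennreal (G x)"]
    by (simp add: GA GN)
  also have "(\<integral>\<^sup>+x. g (m + x) \<partial>lborel) = (\<integral>\<^sup>+x. g x \<partial>lborel)"
    using nn_integral_lborel_affine[of g 1 m] by simp
  finally have "(\<integral>\<^sup>+x. g x \<partial>lborel) * ennreal S * ennreal (1 / S)
      = (\<integral>\<^sup>+x. g (T x) \<partial>lborel) * ennreal N * ennreal (1 / S)"
    by (simp add: T_def)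
  moreover have "ennreal S * ennreal (1 / S) = 1" using S by (simp flip: ennreal_mult'')
  moreover have "ennreal N * ennreal (1 / S) = ennreal \<kappa>"
    using S N_pos by (simp add: \<kappa>_def S_def flip: ennreal_mult'')
  ultimately show ?thesis by (simp add: mult.assoc) (simp add: mult.commute)
qed

text \<open>The measure is specified by its covariance, so \<open>matrix_inv\<close> has to be
  undone first. Then \<open>N\<close> is the normalising constant, the pulled-back weight is
  standard by \<open>G_A\<close>, and \<kappa> / N is the standard normalisation.\<close>

lemma measure_gaussian_T:
  assumes [measurable]: "B \<in> sets borel"
  shows "measure (gaussian_measure m (matrix_inv (n *\<^sub>R H))) B = measure std_gauss (T -` B)"
proof -
  let ?\<Sigma> = "matrix_inv (n *\<^sub>R H)"
  have d: "0 < det (n *\<^sub>R H)" by (rule nn_integral_lborel_pos_def_gaussian(1)[OF pd_nH])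
  then have "\<exists>M. n *\<^sub>R H ** M = mat 1 \<and> M ** (n *\<^sub>R H) = mat 1"
    using invertible_det_nz[of "n *\<^sub>R H"] by (simp add: invertible_def)
  then have \<Sigma>: "n *\<^sub>R H ** ?\<Sigma> = mat 1" "?\<Sigma> ** (n *\<^sub>R H) = mat 1"
    unfolding matrix_inv_def by (metis (mono_tags, lifting) someI_ex)+
  then have "\<exists>M. ?\<Sigma> ** M = mat 1 \<and> M ** ?\<Sigma> = mat 1" by blast
  then have "?\<Sigma> ** matrix_inv ?\<Sigma> = mat 1"
    unfolding matrix_inv_def[of ?\<Sigma>] by (metis (mono_tags, lifting) someI_ex)
  then have inv: "matrix_inv ?\<Sigma> = n *\<^sub>R H"
    using \<Sigma>(1) by (metis matrix_mul_assoc matrix_mul_lid matrix_mul_rid)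
  have "det (n *\<^sub>R H) * det ?\<Sigma> = 1" using \<Sigma>(1) by (metis det_I det_mul)
  then have "det ?\<Sigma> = 1 / det (n *\<^sub>R H)" using d by (simp add: field_simps)
  then have N: "sqrt ((2 * pi) ^ CARD('d) * det ?\<Sigma>) = N" by (simp add: N_def)
  have TB [measurable]: "T -` B \<in> sets borel" using measurable_sets[OF borel_T, of B] by simp
  have "emeasure (gaussian_measure m ?\<Sigma>) B
      = (\<integral>\<^sup>+\<theta>. ennreal (G (\<theta> - m) / N) * indicator B \<theta> \<partial>lborel)"
    unfolding gaussian_measure_def inv N G_def[symmetric]
    by (subst emeasure_density) (auto simp: G_def[symmetric])
  also have "\<dots> = ennreal \<kappa> * (\<integral>\<^sup>+x. ennreal (G (A x) / N) * indicator B (T x) \<partial>lborel)"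
    by (subst nn_integral_T) (auto simp: T_def)
  also have "\<dots> = (\<integral>\<^sup>+x. ennreal (exp (- (norm x)\<^sup>2 / 2) / sqrt (2 * pi) ^ CARD('d)) * indicator (T -` B) x \<partial>lborel)"
    using \<kappa>_pos N_pos
    by (subst nn_integral_cmult[symmetric])
      (auto intro!: nn_integral_cong simp: G_A \<kappa>_def ennreal_mult'[symmetric] indicator_def)
  also have "\<dots> = emeasure std_gauss (T -` B)"
    unfolding std_gauss_def by (subst emeasure_density) auto
  finally show ?thesis by (simp add: measure_def)
qed

text \<open>A Borel representative of the Gibbs weight: \<open>\<Theta>\<close> itself may fail to
  be Borel, whereas substitution by \<open>T\<close> is carried out for Borel functions.\<close>

definition \<phi> :: "real^'d \<Rightarrow> real" where "\<phi> \<theta> = indicator (interior \<Theta>) \<theta> * exp (- n * f \<theta>)"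

lemma \<phi>_nonneg: "0 \<le> \<phi> \<theta>" by (simp add: \<phi>_def)

lemma borel_\<phi> [measurable]: "\<phi> \<in> borel_measurable borel"
proof -
  have "continuous_on \<Theta> f" using C2 by (simp add: C2_on_def differentiable_imp_continuous_on)
  then have "continuous_on (interior \<Theta>) f" using interior_subset by (rule continuous_on_subset)
  then have "(\<lambda>\<theta>. indicator (interior \<Theta>) \<theta> *\<^sub>R exp (- n * f \<theta>)) \<in> borel_measurable borel"
    by (intro borel_measurable_continuous_on_indicator continuous_intros) auto
  then show ?thesis by (simp add: \<phi>_def[abs_def])
qed

lemma \<phi>_T: "\<phi> (T x) = exp (- n * f m) * ng.p x"
  unfolding \<phi>_def ng.p_def
  by (simp add: V_def \<Omega>_def exp_add[symmetric] indicator_def algebra_simps)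

lemma has_integral_\<phi>:
  assumes [measurable]: "B \<in> sets borel"
  shows "has_bochner_integral lborel (\<lambda>\<theta>. indicator B \<theta> * \<phi> \<theta>)
    (\<kappa> * exp (- n * f m) * (\<integral>x. indicator (T -` B) x * ng.p x \<partial>lborel))"
proof (rule has_bochner_integral_nn_integral)
  have [measurable]: "T -` B \<in> sets borel" using measurable_sets[OF borel_T, of B] by simp
  have i: "integrable lborel (\<lambda>x. indicator (T -` B) x * ng.p x)"
    using integrable_real_mult_indicator[OF _ ng.integrable_p, of "T -` B"] by (simp add: mult.commute)
  have "(\<integral>\<^sup>+\<theta>. ennreal (indicator B \<theta> * \<phi> \<theta>) \<partial>lborel)
    = ennreal \<kappa> * (\<integral>\<^sup>+x. ennreal (exp (- n * f m)) * ennreal (indicator (T -` B) x * ng.p x) \<partial>lborel)"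
    by (subst nn_integral_T)
      (auto simp: \<phi>_T ennreal_mult'[symmetric] indicator_def intro!: arg_cong2[where f = "(*)"] nn_integral_cong)
  also have "\<dots> = ennreal \<kappa> * (ennreal (exp (- n * f m)) * ennreal (\<integral>x. indicator (T -` B) x * ng.p x \<partial>lborel))"
    using ng.p_nonneg by (simp add: nn_integral_cmult nn_integral_eq_integral[OF i])
  also have "\<dots> = ennreal (\<kappa> * exp (- n * f m) * (\<integral>x. indicator (T -` B) x * ng.p x \<partial>lborel))"
    using \<kappa>_pos by (simp add: ennreal_mult' mult.assoc)
  finally show "(\<integral>\<^sup>+\<theta>. ennreal (indicator B \<theta> * \<phi> \<theta>) \<partial>lborel)
    = ennreal (\<kappa> * exp (- n * f m) * (\<integral>x. indicator (T -` B) x * ng.p x \<partial>lborel))" .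
qed (use ng.p_nonneg \<kappa>_pos in \<open>auto simp: \<phi>_nonneg intro!: mult_nonneg_nonneg integral_nonneg_AE\<close>)

definition "Z = \<kappa> * exp (- n * f m) * ng.Zp"

lemma Z_pos: "0 < Z" using \<kappa>_pos ng.Zq_ge_1 ng.Zp_bounds by (simp add: Z_def)

lemma has_integral_\<phi>_UNIV: "has_bochner_integral lborel \<phi> Z"
  using has_integral_\<phi>[of UNIV] by (simp add: Z_def ng.Zp_def)

lemma lebesgue_weight:
  "(\<lambda>\<theta>. indicator \<Theta> \<theta> * exp (- n * f \<theta>)) \<in> borel_measurable lebesgue"
  "AE \<theta> in lebesgue. indicator \<Theta> \<theta> * exp (- n * f \<theta>) = \<phi> \<theta>"
proof -
  have "continuous_on \<Theta> (\<lambda>\<theta>. exp (- n * f \<theta>))"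
    using C2 by (intro continuous_intros) (simp add: C2_on_def differentiable_imp_continuous_on)
  then have "(\<lambda>\<theta>. exp (- n * f \<theta>)) \<in> borel_measurable (lebesgue_on \<Theta>)"
    by (rule continuous_imp_measurable_on_sets_lebesgue[OF _ sets_lebesgue_convex[OF convex_\<Theta>]])
  then have "(\<lambda>\<theta>. if \<theta> \<in> \<Theta> then exp (- n * f \<theta>) else 0) \<in> borel_measurable lebesgue"
    using sets_lebesgue_convex[OF convex_\<Theta>] by (simp add: borel_measurable_if)
  also have "(\<lambda>\<theta>. if \<theta> \<in> \<Theta> then exp (- n * f \<theta>) else 0) = (\<lambda>\<theta>. indicator \<Theta> \<theta> * exp (- n * f \<theta>))"
    by (auto simp: fun_eq_iff)
  finally show "(\<lambda>\<theta>. indicator \<Theta> \<theta> * exp (- n * f \<theta>)) \<in> borel_measurable lebesgue" .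
  have "frontier \<Theta> \<in> null_sets lebesgue"
    using negligible_convex_frontier[OF convex_\<Theta>] by (simp add: negligible_iff_null_sets)
  then have "AE \<theta> in lebesgue. \<theta> \<notin> frontier \<Theta>" by (rule AE_not_in)
  then show "AE \<theta> in lebesgue. indicator \<Theta> \<theta> * exp (- n * f \<theta>) = \<phi> \<theta>"
  proof eventually_elim
    case (elim \<theta>)
    then have "\<theta> \<in> \<Theta> \<longleftrightarrow> \<theta> \<in> interior \<Theta>"
      using closure_subset[of \<Theta>] interior_subset[of \<Theta>] by (auto simp: frontier_def)
    then show ?case by (simp add: \<phi>_def indicator_def)
  qed
qed

lemma set_integrable_weight: "set_integrable lebesgue \<Theta> (\<lambda>\<theta>. exp (- n * f \<theta>))"
  and set_integral_weight: "(LINT \<theta>:\<Theta>|lebesgue. exp (- n * f \<theta>)) = Z"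
proof -
  have m: "\<phi> \<in> borel_measurable lebesgue" using borel_\<phi> by (intro measurable_completion) simp
  have "integrable lebesgue \<phi>"
    using has_integral_\<phi>_UNIV by (simp add: integrable_completion has_bochner_integral_iff)
  then have "integrable lebesgue (\<lambda>\<theta>. indicator \<Theta> \<theta> * exp (- n * f \<theta>))"
    using integrable_cong_AE[OF lebesgue_weight(1) m lebesgue_weight(2)] by simp
  then show "set_integrable lebesgue \<Theta> (\<lambda>\<theta>. exp (- n * f \<theta>))" by (simp add: set_integrable_def)
  have "(\<integral>\<theta>. indicator \<Theta> \<theta> * exp (- n * f \<theta>) \<partial>lebesgue) = integral\<^sup>L lebesgue \<phi>"
    by (rule integral_cong_AE[OF lebesgue_weight(1) m lebesgue_weight(2)])
  then show "(LINT \<theta>:\<Theta>|lebesgue. exp (- n * f \<theta>)) = Z"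
    using has_integral_\<phi>_UNIV
    by (simp add: set_lebesgue_integral_def integral_completion has_bochner_integral_iff)
qed

lemma emeasure_gibbs:
  assumes [measurable]: "B \<in> sets borel"
  shows "emeasure (gibbs_measure \<Theta> n f) B
    = ennreal ((\<integral>x. indicator (T -` B) x * ng.p x \<partial>lborel) / ng.Zp)"
proof -
  let ?w = "\<lambda>\<theta>. ennreal (indicator \<Theta> \<theta> * exp (- n * f \<theta>) / Z)"
  have w: "?w \<in> borel_measurable lebesgue"
    using measurable_compose[OF borel_measurable_divide[OF lebesgue_weight(1) borel_measurable_const]
        measurable_ennreal] .
  have B: "B \<in> sets lebesgue" by simp
  have "emeasure (gibbs_measure \<Theta> n f) B = (\<integral>\<^sup>+\<theta>. ?w \<theta> * indicator B \<theta> \<partial>lebesgue)"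
    unfolding gibbs_measure_def set_integral_weight by (rule emeasure_density[OF w B])
  also have "\<dots> = (\<integral>\<^sup>+\<theta>. ennreal (indicator B \<theta> * \<phi> \<theta> / Z) \<partial>lebesgue)"
    using lebesgue_weight(2)
    by (intro nn_integral_cong_AE) (auto elim!: eventually_mono simp: indicator_def)
  also have "\<dots> = (\<integral>\<^sup>+\<theta>. ennreal (indicator B \<theta> * \<phi> \<theta> / Z) \<partial>lborel)"
    by (rule nn_integral_completion)
  also have "\<dots> = ennreal (\<kappa> * exp (- n * f m) * (\<integral>x. indicator (T -` B) x * ng.p x \<partial>lborel) / Z)"
    using has_integral_\<phi>[OF assms] Z_pos \<phi>_nonneg
    by (subst nn_integral_eq_integral) (auto simp: has_bochner_integral_iff less_imp_le)
  also have "\<kappa> * exp (- n * f m) * (\<integral>x. indicator (T -` B) x * ng.p x \<partial>lborel) / Z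
     = (\<integral>x. indicator (T -` B) x * ng.p x \<partial>lborel) / ng.Zp"
    using \<kappa>_pos by (simp add: Z_def)
  finally show ?thesis .
qed

lemma prob_space_gibbs: "prob_space (gibbs_measure \<Theta> n f)"
proof
  have "space (gibbs_measure \<Theta> n f) = UNIV" by (simp add: gibbs_measure_def)
  moreover have "0 < ng.Zp" using ng.Zq_ge_1 ng.Zp_bounds by simp
  ultimately show "emeasure (gibbs_measure \<Theta> n f) (space (gibbs_measure \<Theta> n f)) = 1"
    by (simp add: emeasure_gibbs ng.Zp_def[symmetric])
qed

lemma total_variation_le:
  "total_variation (gibbs_measure \<Theta> n f) (gaussian_measure m (matrix_inv (n *\<^sub>R H)))
    \<le> \<delta> * CARD('d) / sqrt (2 * n) + 3 * exp (- real CARD('d) * r\<^sup>2 / 9)"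
  unfolding total_variation_def
proof (rule cSUP_least)
  fix B :: "(real^'d) set" assume B: "B \<in> sets borel"
  have TB: "T -` B \<in> sets borel" using measurable_sets[OF borel_T B] by simp
  have "0 \<le> (\<integral>x. indicator (T -` B) x * ng.p x \<partial>lborel) / ng.Zp"
    using ng.Zq_ge_1 ng.Zp_bounds ng.p_nonneg
    by (intro divide_nonneg_nonneg integral_nonneg_AE) auto
  then have "measure (gibbs_measure \<Theta> n f) B = (\<integral>x. indicator (T -` B) x * ng.p x \<partial>lborel) / ng.Zp"
    by (simp add: measure_def emeasure_gibbs[OF B])
  then show "\<bar>measure (gibbs_measure \<Theta> n f) B - measure (gaussian_measure m (matrix_inv (n *\<^sub>R H))) B\<bar>
     \<le> \<delta> * CARD('d) / sqrt (2 * n) + 3 * exp (- real CARD('d) * r\<^sup>2 / 9)"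
    using ng.tv_bound[OF TB] by (simp add: measure_gaussian_T[OF B] L_def real_sqrt_mult mult_ac)
qed auto

end

theorem theorem2p2:
  fixes \<Theta> :: "(real^'d) set" and f :: "real^'d \<Rightarrow> real" and \<theta>' :: "real^'d"
    and H :: "real^'d^'d" and n r :: real
  assumes "convex \<Theta>"
    and "n > 0"
    and "C2_on \<Theta> f"
    and "convex_on \<Theta> f"
    and "strict_global_minimizer \<Theta> f \<theta>'"
    and "H = hessian_within \<Theta> f \<theta>'"
    and "pos_def H"
    and "r \<ge> 6"
    and "local_region n H \<theta>' r \<subseteq> \<Theta>"
    and "ereal r * delta3 \<Theta> f n \<theta>' r * ereal (sqrt (real CARD('d) / n)) \<le> ereal (1 / 2)"
  shows "set_integrable lebesgue \<Theta> (\<lambda>\<theta>. exp (- n * f \<theta>)) \<and>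
    prob_space (gibbs_measure \<Theta> n f) \<and>
    ereal (total_variation (gibbs_measure \<Theta> n f) (gaussian_measure \<theta>' (matrix_inv (n *\<^sub>R H))))
      \<le> delta3 \<Theta> f n \<theta>' r * ereal (real CARD('d)) / ereal (sqrt (2 * n))
         + ereal (3 * exp (- real CARD('d) * r\<^sup>2 / 9))"
proof -
  let ?D = "delta3 \<Theta> f n \<theta>' r"
  let ?c = "sqrt (real CARD('d) / n)"
  let ?K = "matrix_sqrt H"
  let ?U = "local_region n H \<theta>' r"
  let ?q = "\<lambda>x. mat_norm_wrt H (hessian_within \<Theta> f x - H) / vec_norm_wrt H (x - \<theta>')"
  have D: "?D = (SUP x \<in> ?U - {\<theta>'}. ereal (?q x))"
    unfolding delta3_def Let_def assms(6)[symmetric] by simp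
  have c: "0 < ?c" using assms(2) by simp
  have q_nonneg: "0 \<le> ?q x" for x
    unfolding mat_norm_wrt_def vec_norm_wrt_def
    by (intro divide_nonneg_nonneg onorm_pos_le matrix_vector_mul_bounded_linear) auto
  have K: "?K *v x = 0 \<Longrightarrow> x = 0" for x
    using matrix_sqrt(1)[OF assms(7)] by (auto simp: pos_def_def)
  \<comment> \<open>Any nonzero direction will do. The resulting point \<open>y\<close> has distance
    exactly r times \<open>?c\<close> from the minimiser, so the supremum ranges over a nonempty set
    and is nonnegative; over the empty set it would be -\<infinity>.\<close>
  define e :: "real^'d" where "e = axis undefined 1"
  have e: "?K *v e \<noteq> 0" using K[of e] by (auto simp: e_def)
  define y where "y = \<theta>' + (r * ?c / norm (?K *v e)) *\<^sub>R e"
  have "y \<in> ?U"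
    using e c assms(8) by (simp add: y_def local_region_def vec_norm_wrt_def matrix_vector_mult_scaleR)
  moreover have "y \<noteq> \<theta>'" using e c assms(8) by (auto simp: y_def)
  ultimately have "ereal (?q y) \<le> ?D" unfolding D by (intro SUP_upper) auto
  then have D0: "0 \<le> ?D" using q_nonneg[of y] by (meson ereal_less_eq(5) order_trans)
  \<comment> \<open>Finiteness is hidden in the smallness assumption: with positive factors on both
    sides, an infinite supremum would make its left side infinite.\<close>
  moreover have "?D \<noteq> \<infinity>"
  proof
    assume "?D = \<infinity>"
    moreover have "ereal r * \<infinity> * ereal k = \<infinity>" if "0 < k" for k
      using that assms(8) by simp
    ultimately show False using assms(10) c by (metis PInfty_neq_ereal(1) ereal_infty_less_eq(1))
  qed
  ultimately obtain \<delta> where \<delta>: "?D = ereal \<delta>" by (cases ?D) auto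
  interpret laplace_setting \<Theta> f \<theta>' H n r \<delta>
  proof
    show "0 \<le> \<delta>" using D0 \<delta> by simp
    show "r * \<delta> * ?c \<le> 1 / 2" using assms(10) \<delta> by simp
    fix x assume x: "x \<in> ?U" "x \<noteq> \<theta>'"
    have "ereal (?q x) \<le> ereal \<delta>" unfolding \<delta>[symmetric] D using x by (intro SUP_upper) auto
    moreover have "0 < vec_norm_wrt H (x - \<theta>')" using K[of "x - \<theta>'"] x by (auto simp: vec_norm_wrt_def)
    ultimately show "mat_norm_wrt H (hessian_within \<Theta> f x - H) \<le> \<delta> * vec_norm_wrt H (x - \<theta>')"
      by (simp add: pos_divide_le_eq)
  qed fact+
  have "ereal (total_variation (gibbs_measure \<Theta> n f) (gaussian_measure \<theta>' (matrix_inv (n *\<^sub>R H))))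
      \<le> ?D * ereal (real CARD('d)) / ereal (sqrt (2 * n)) + ereal (3 * exp (- real CARD('d) * r\<^sup>2 / 9))"
    using total_variation_le assms(2) unfolding \<delta> by simp
  then show ?thesis using set_integrable_weight prob_space_gibbs by blast
qed

end
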